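(* Let $n\ge3$ and $\omega\in\widetilde A_n$. Then $\widetilde F_\omega=\Gamma(\mathrm{Inv}_{\widetilde A}(\omega),\mathcal{U}^{col})$, where $\widetilde F_\omega$ is the affine Stanley symmetric function of $\omega$.
   Context: $\widetilde A_n$: Coxeter group with generators $s_1,\dots,s_n$ (indices in $\mathbb{Z}/n\mathbb{Z}$), realized as affine permutations $\sigma:\mathbb{Z}\to\mathbb{Z}$ (bijections with $\sigma(q+kn)=\sigma(q)+kn$ and $\sum_{i=1}^n\sigma(i)=n(n+1)/2$), $s_i$ swapping positions of $i+kn$ and $i+1+kn$; $\ell$ is the length. $\mathrm{Inv}_{\widetilde A}(\omega)=\{(a,b)\in[n]\times\mathbb{N}^*:a<b,\ \omega^{-1}(a)>\omega^{-1}(b)\}$. $\widetilde{\mathcal{A}}$ is the valued digraph with vertices $\lambda_n^{cyl}=\{(a,b)\in\mathbb{N}^2:1\le a\le n,\ a<b,\ b\not\equiv a\ (\mathrm{mod}\ n)\}$, an arc $\mathfrak{c}\to\mathfrak{d}$ iff $\mathfrak{c}\ne\mathfrak{d}$ and $\mathfrak{d}\in H^{cyl}(\mathfrak{c})$, where $H^{cyl}(a,b)=\{(a,k)\in\lambda_n^{cyl}:a<k<b\}\cup\bigcup_{q\equiv b\ (\mathrm{mod}\ n),\,q\le b}\{(k,q)\in\lambda_n^{cyl}:a<k<b\}$, and $\theta(a,b)=|\{(a,k)\in\lambda_n^{cyl}:a<k<b\}|$. Peeling process: repeatedly choose an erasable vertex $x_i$ (value $0$, and every vertex with an arc into it has nonzero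 value), delete it with incident arcs, and decrease by $1$ the value of each $y$ with an arc $(y,x_i)$. For a finite vertex set $A$, $PS_A$ is the set of enumerations $[z_1,\dots,z_{|A|}]$ of $A$ that are the first $|A|$ terms of a peeling sequence of $\widetilde{\mathcal{A}}$. $\mathcal{U}^{col}_{(a,b)}=\{(a,k):a<k,\ k\not\equiv a\ (\mathrm{mod}\ n)\}$. $f:A\to\mathbb{N}^*$ is semi-standard if some $[z_1,\dots,z_m]\in PS_A$ satisfies for all $i<j$: $f(z_i)\le f(z_j)$, strictly if $z_j\in\mathcal{U}^{col}_{z_i}$; $\Gamma(A,\mathcal{U}^{col})=\sum_f\prod_{z\in A}x_{f(z)}$. A sequence $(i_1,\dots,i_k)$ in $\mathbb{Z}/n\mathbb{Z}$ is cyclically decreasing if each element occurs at most once and whenever $i_p=j$ and $i_q=j+1$ we have $q<p$; $v\in\widetilde A_n$ is cyclically decreasing if it has a reduced decomposition $s_{i_1}\cdots s_{i_k}$ with $(i_1,\dots,i_k)$ cyclically decreasing ($\mathrm{Id}$ included). $\widetilde F_\omega=\sum x_1^{\ell(v_1)}x_2^{\ell(v_2)}\cdots$, summed over all sequences $(v_1,v_2,\dots)$ of cyclically decreasing elements, all but finitely many equal to $\mathrm{Id}$, with $\omega=v_1v_2\cdots$ and $\ell(\omega)=\sum_i\ell(v_i)$.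
   Formalization: The second part of H^cyl(a,b) is taken as all (k,q) in λ_n^cyl with q≡b (mod n), q≤b and a<k+(b−q)<b instead of a<k<b; as printed the claim fails for n=3, ω=s_1s_3, where PS of Inv(ω)={(1,2),(3,5)} is empty (so Γ=0) but the Stanley function is nonzero. *)

theory Defs
  imports
    "HOL-Library.FuncSet"
    "HOL-Library.Poly_Mapping"
    "HOL-Number_Theory.Cong"
    "Graph_Theory.Pair_Digraph"
begin

section \<open>Formal power series in the variables \<open>x\<^sub>1, x\<^sub>2, \<dots>\<close>\<close>

text \<open>
  A monomial is its finitely supported exponent function, and a power series is the function
  giving the coefficient of each monomial. The index \<open>0\<close> is never used as a variable.
\<close>

type_synonym monomial = "nat \<Rightarrow>\<^sub>0 nat"
type_synonym power_series = "monomial \<Rightarrow> nat"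

text \<open>
  The formal sum of the monomials \<open>mon i\<close> for \<open>i \<in> I\<close>. It is meaningful when each monomial
  arises from finitely many \<open>i\<close>. This holds for the two series below: only finitely many
  functions from a finite set have a given content, and a group generated by \<open>n\<close> elements has
  finitely many elements of a given length.
\<close>

definition formal_sum :: "('i \<Rightarrow> monomial) \<Rightarrow> 'i set \<Rightarrow> power_series" where
  "formal_sum mon I = (\<lambda>m. card {i \<in> I. mon i = m})"

section \<open>Affine permutations\<close>

text \<open>The product of the group is composition of functions.\<close>

definition affine_permutations :: "nat \<Rightarrow> (int \<Rightarrow> int) set" where
  "affine_permutations n =
    {\<sigma>. bij \<sigma> \<and> (\<forall>q k. \<sigma> (q + k * int n) = \<sigma> q + k * int n)
        \<and> (\<Sum>i = 1..int n. \<sigma> i) = int (n * (n + 1) div 2)}"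

text \<open>
  As a permutation, \<open>s\<^sub>i\<close> exchanges \<open>i + kn\<close> and \<open>i + 1 + kn\<close> for all \<open>k\<close>; hence
  \<open>\<sigma> \<circ> s\<^sub>i\<close> is \<open>\<sigma>\<close> with the positions \<open>i + kn\<close> and \<open>i + 1 + kn\<close> swapped.
\<close>

definition simple_reflection :: "nat \<Rightarrow> int \<Rightarrow> int \<Rightarrow> int" where
  "simple_reflection n i q =
    (if [q = i] (mod int n) then q + 1
     else if [q = i + 1] (mod int n) then q - 1
     else q)"

text \<open>Words in the generators; \<open>\<int>/n\<int>\<close> is represented by \<open>{1..n}\<close>.\<close>

definition index_words :: "nat \<Rightarrow> int list set" where
  "index_words n = lists {1..int n}"

definition word_product :: "nat \<Rightarrow> int list \<Rightarrow> (int \<Rightarrow> int)" where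
  "word_product n is = foldr (\<circ>) (map (simple_reflection n) is) id"

definition coxeter_length :: "nat \<Rightarrow> (int \<Rightarrow> int) \<Rightarrow> nat" where
  "coxeter_length n \<sigma> = (LEAST k. \<exists>is \<in> index_words n. length is = k \<and> word_product n is = \<sigma>)"

definition reduced_decompositions :: "nat \<Rightarrow> (int \<Rightarrow> int) \<Rightarrow> int list set" where
  "reduced_decompositions n \<sigma> =
    {is \<in> index_words n. word_product n is = \<sigma> \<and> length is = coxeter_length n \<sigma>}"

definition Inv_affine :: "nat \<Rightarrow> (int \<Rightarrow> int) \<Rightarrow> (nat \<times> nat) set" where
  "Inv_affine n \<omega> =
    {(a, b). a \<in> {1..n} \<and> 1 \<le> b \<and> a < b \<and> inv \<omega> (int a) > inv \<omega> (int b)}"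

section \<open>Affine Stanley symmetric functions\<close>

definition cyclically_decreasing_word :: "nat \<Rightarrow> int list \<Rightarrow> bool" where
  "cyclically_decreasing_word n is \<longleftrightarrow>
    is \<in> index_words n \<and> distinct is \<and>
    (\<forall>p < length is. \<forall>q < length is. [is ! q = is ! p + 1] (mod int n) \<longrightarrow> q < p)"

definition cyclically_decreasing :: "nat \<Rightarrow> (int \<Rightarrow> int) set" where
  "cyclically_decreasing n =
    {v \<in> affine_permutations n. \<exists>is \<in> reduced_decompositions n v. cyclically_decreasing_word n is}"

text \<open>
  The sequences \<open>(v\<^sub>1, v\<^sub>2, \<dots>)\<close> are functions on \<open>{1..}\<close>; beyond the index \<open>N\<close> all
  factors are trivial, so the infinite product and the sum of lengths stop there.
\<close>

definition cyclic_factorizations :: "nat \<Rightarrow> (int \<Rightarrow> int) \<Rightarrow> (nat \<Rightarrow> int \<Rightarrow> int) set" where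
  "cyclic_factorizations n \<omega> =
    {v \<in> {1..} \<rightarrow>\<^sub>E cyclically_decreasing n.
       \<exists>N. (\<forall>i > N. v i = id)
         \<and> \<omega> = foldr (\<circ>) (map v [1..<Suc N]) id
         \<and> coxeter_length n \<omega> = (\<Sum>i = 1..N. coxeter_length n (v i))}"

definition affine_stanley :: "nat \<Rightarrow> (int \<Rightarrow> int) \<Rightarrow> power_series" where
  "affine_stanley n \<omega> =
    formal_sum
      (\<lambda>v. \<Sum>i \<in> {i. 1 \<le> i \<and> v i \<noteq> id}. Poly_Mapping.single i (coxeter_length n (v i)))
      (cyclic_factorizations n \<omega>)"

section \<open>Valued digraphs and the peeling process\<close>

record 'v valued_digraph = "'v pair_pre_digraph" +
  pvalue :: "'v \<Rightarrow> nat"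

definition erasable :: "'v valued_digraph \<Rightarrow> 'v \<Rightarrow> bool" where
  "erasable G x \<longleftrightarrow>
    x \<in> pverts G \<and> pvalue G x = 0 \<and> (\<forall>y. (y, x) \<in> parcs G \<longrightarrow> pvalue G y \<noteq> 0)"

definition peel :: "'v valued_digraph \<Rightarrow> 'v \<Rightarrow> 'v valued_digraph" where
  "peel G x =
    \<lparr> pverts = pverts G - {x},
      parcs = {(y, z) \<in> parcs G. y \<noteq> x \<and> z \<noteq> x},
      pvalue = (\<lambda>y. if (y, x) \<in> parcs G then pvalue G y - 1 else pvalue G y) \<rparr>"

text \<open>
  A peeling sequence goes on as long as there is an erasable vertex, possibly forever;
  \<open>None\<close> marks the terms after the end of a finite one.
\<close>

primrec peel_steps :: "'v valued_digraph \<Rightarrow> (nat \<Rightarrow> 'v option) \<Rightarrow> nat \<Rightarrow> 'v valued_digraph" where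
  "peel_steps G xs 0 = G"
| "peel_steps G xs (Suc i) =
    (case xs i of None \<Rightarrow> peel_steps G xs i | Some x \<Rightarrow> peel (peel_steps G xs i) x)"

definition peeling_sequence :: "'v valued_digraph \<Rightarrow> (nat \<Rightarrow> 'v option) \<Rightarrow> bool" where
  "peeling_sequence G xs \<longleftrightarrow>
    (\<forall>i. case xs i of
           None \<Rightarrow> (\<nexists>x. erasable (peel_steps G xs i) x)
         | Some x \<Rightarrow> erasable (peel_steps G xs i) x)"

definition PS :: "'v valued_digraph \<Rightarrow> 'v set \<Rightarrow> 'v list set" where
  "PS G A =
    {zs. distinct zs \<and> set zs = A \<and>
         (\<exists>xs. peeling_sequence G xs \<and> (\<forall>i < length zs. xs i = Some (zs ! i)))}"

definition semi_standard ::
    "'v valued_digraph \<Rightarrow> 'v set \<Rightarrow> ('v \<Rightarrow> 'v set) \<Rightarrow> ('v \<Rightarrow> nat) \<Rightarrow> bool" where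
  "semi_standard G A U f \<longleftrightarrow>
    (\<exists>zs \<in> PS G A. \<forall>i j. i < j \<and> j < length zs \<longrightarrow>
       f (zs ! i) \<le> f (zs ! j) \<and> (zs ! j \<in> U (zs ! i) \<longrightarrow> f (zs ! i) < f (zs ! j)))"

definition Gamma_series :: "'v valued_digraph \<Rightarrow> 'v set \<Rightarrow> ('v \<Rightarrow> 'v set) \<Rightarrow> power_series" where
  "Gamma_series G A U =
    formal_sum (\<lambda>f. \<Sum>z \<in> A. Poly_Mapping.single (f z) 1)
      {f \<in> A \<rightarrow>\<^sub>E {1..}. semi_standard G A U f}"

section \<open>The valued digraph of type affine A\<close>

definition lambda_cyl :: "nat \<Rightarrow> (nat \<times> nat) set" where
  "lambda_cyl n = {(a, b). 1 \<le> a \<and> a \<le> n \<and> a < b \<and> \<not> [b = a] (mod n)}"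

text \<open>
  A vertex \<open>(a, b)\<close> stands for all its translates \<open>(a + jn, b + jn)\<close>. The second part of the
  hook consists of the pairs \<open>(k, b)\<close> with \<open>a < k < b\<close>, each represented by its translate
  \<open>(k - jn, b - jn)\<close> in \<open>lambda_cyl n\<close>. So the bounds apply to the first component after
  it has been translated back by \<open>b - q\<close>, not to the representative itself. Imposing
  \<open>a < k < b\<close> on the representative would lose hook elements: for \<open>n = 3\<close>, the hook
  of \<open>(3, 5)\<close> would no longer contain \<open>(1, 2)\<close>, which represents \<open>(4, 5)\<close>, and no peeling
  sequence would begin with the inversions \<open>{(1, 2), (3, 5)}\<close> of \<open>s\<^sub>1 s\<^sub>3\<close>.
\<close>

definition hook_cyl :: "nat \<Rightarrow> nat \<times> nat \<Rightarrow> (nat \<times> nat) set" where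
  "hook_cyl n = (\<lambda>(a, b).
     {(a', k) \<in> lambda_cyl n. a' = a \<and> a < k \<and> k < b} \<union>
     (\<Union>q \<in> {q. q \<le> b \<and> [q = b] (mod n)}.
        {(k, q') \<in> lambda_cyl n. q' = q \<and> a < k + (b - q) \<and> k + (b - q) < b}))"

definition theta_cyl :: "nat \<Rightarrow> nat \<times> nat \<Rightarrow> nat" where
  "theta_cyl n = (\<lambda>(a, b). card {(a', k) \<in> lambda_cyl n. a' = a \<and> a < k \<and> k < b})"

definition affine_digraph :: "nat \<Rightarrow> (nat \<times> nat) valued_digraph" where
  "affine_digraph n =
    \<lparr> pverts = lambda_cyl n,
      parcs = {(c, d) \<in> lambda_cyl n \<times> lambda_cyl n. c \<noteq> d \<and> d \<in> hook_cyl n c},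
      pvalue = theta_cyl n \<rparr>"

definition U_col :: "nat \<Rightarrow> nat \<times> nat \<Rightarrow> (nat \<times> nat) set" where
  "U_col n = (\<lambda>(a, b). {(a', k). a' = a \<and> a < k \<and> \<not> [k = a] (mod n)})"

end

theory Submission
  imports Defs
begin

text \<open>
  After the inversions of an affine permutation \<open>u\<close> have been peeled off, the value
  of a remaining vertex \<open>(a, b)\<close> is the number of \<open>k\<close> between \<open>a\<close> and \<open>b\<close>, not congruent to \<open>a\<close>, with
  \<open>u\<^sup>-\<^sup>1 k\<close> between \<open>u\<^sup>-\<^sup>1 a\<close> and \<open>u\<^sup>-\<^sup>1 b\<close>. Hence \<open>(a, b)\<close> is erasable iff \<open>u\<^sup>-\<^sup>1 b = u\<^sup>-\<^sup>1 a + 1\<close>, that is,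
  iff erasing it is a step \<open>u \<rightarrow> u s\<^sub>i\<close> upwards in the right weak order. So the members of
  \<open>PS\<close> are the enumerations all of whose prefixes are inversion sets.

  An element is cyclically decreasing iff no integer is the smaller entry of two of its
  inversions. Consequently a factorization \<open>v\<^sub>1 v\<^sub>2 \<dots>\<close> of \<open>\<omega>\<close> corresponds to the semi-standard
  filling that sends an inversion to the first \<open>i\<close> for which it is an inversion of \<open>v\<^sub>1 \<dots> v\<^sub>i\<close>.
\<close>

text \<open>A vanishing value only says that no entry between \<open>a\<close> and \<open>b\<close>
  stands between their positions. Smaller or larger entries may still stand there. They are excluded
  by the other half of erasability: every remaining vertex \<open>(a, d)\<close> with
  \<open>d > b\<close>, and every remaining translate of \<open>(c, b)\<close> with
  \<open>c < a\<close>, has an entry between its two in value and position, and following such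
  entries leads to a descent. The obstacle is periodicity: the entry found may be a translate of
  \<open>a\<close> or \<open>b\<close>, and the corresponding pair is then no vertex.

  On the side of factorizations, the inversions of \<open>inv u \<circ> w\<close> are those of
  \<open>w\<close> that are not inversions of \<open>u\<close>, relabelled by \<open>inv u\<close>,
  provided that \<open>u\<close> is below \<open>w\<close>. Relabelling preserves a common smaller
  entry, so a factor is cyclically decreasing iff the inversions that it adds have distinct first
  components; this is strictness along the columns. The length condition becomes the inclusion of
  successive inversion sets.\<close>

definition inverted :: "(int \<Rightarrow> int) \<Rightarrow> int \<Rightarrow> int \<Rightarrow> bool" where
  "inverted w x y \<longleftrightarrow> x < y \<and> inv w y < inv w x"

lemma mem_Inv_affine:
  \<comment> \<open>For affine permutations \<open>inverted\<close> is invariant under translation;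
    \<open>Inv_affine\<close> keeps from each class the pair whose smaller entry lies in
    \<open>{1..n}\<close>.\<close>
  "(a, b) \<in> Inv_affine n w \<longleftrightarrow> 1 \<le> a \<and> a \<le> n \<and> inverted w (int a) (int b)"
  by (auto simp: Inv_affine_def inverted_def)

lemma sum_int_interval: "(\<Sum>i = 1..int m. i) = int (m * (m + 1) div 2)"
proof -
  have "(\<Sum>i = 1..int m. i) = (\<Sum>i = 1..m. int i)"
    by (rule sum.reindex_bij_witness[of _ int nat]) auto
  also have "\<dots> = int (\<Sum>i = 1..m. i)" by simp
  also have "(\<Sum>i = 1..m. i) = m * (m + 1) div 2"
    by (induction m) auto
  finally show ?thesis .
qed

locale affine_type =
  fixes n :: nat
  assumes n_ge_3: "3 \<le> n"
begin

abbreviation "Aff \<equiv> affine_permutations n"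
abbreviation "srefl \<equiv> simple_reflection n"
abbreviation "I \<equiv> Inv_affine n"

subsection \<open>The group of affine permutations\<close>

lemma Aff_bij: "w \<in> Aff \<Longrightarrow> bij w"
  by (simp add: affine_permutations_def)

lemma Aff_shift: "w \<in> Aff \<Longrightarrow> w (q + k * int n) = w q + k * int n"
  by (simp add: affine_permutations_def)

lemma Aff_inv_left [simp]: "w \<in> Aff \<Longrightarrow> inv w (w q) = q"
  by (simp add: Aff_bij bij_is_inj)

lemma Aff_inv_right [simp]: "w \<in> Aff \<Longrightarrow> w (inv w q) = q"
  by (simp add: Aff_bij bij_is_surj surj_f_inv_f)

lemma inv_shift: "w \<in> Aff \<Longrightarrow> inv w (q + k * int n) = inv w q + k * int n"
  using Aff_inv_left[of w "inv w q + k * int n"] by (simp add: Aff_shift)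

lemma Aff_eq_iff: "w \<in> Aff \<Longrightarrow> w x = w y \<longleftrightarrow> x = y"
  by (metis Aff_inv_left)

lemma inv_eq_iff: "w \<in> Aff \<Longrightarrow> inv w x = inv w y \<longleftrightarrow> x = y"
  by (metis Aff_inv_right)

lemma inv_comp: "u \<in> Aff \<Longrightarrow> w \<in> Aff \<Longrightarrow> inv (u \<circ> w) = inv w \<circ> inv u"
  by (simp add: Aff_bij o_inv_distrib)

lemma residue_exists: "\<exists>k. 1 \<le> x + k * int n \<and> x + k * int n \<le> int n"
proof
  have "(x - 1) mod int n = x - 1 + - ((x - 1) div int n) * int n"
    by (simp add: minus_div_mult_eq_mod [symmetric])
  moreover have "0 \<le> (x - 1) mod int n" "(x - 1) mod int n < int n"
    using n_ge_3 by simp_all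
  ultimately show "1 \<le> x + - ((x - 1) div int n) * int n \<and> x + - ((x - 1) div int n) * int n \<le> int n"
    by simp
qed

lemma residue_unique:
  assumes "1 \<le> x" "x \<le> int n" "1 \<le> y" "y \<le> int n" "y = x + k * int n"
  shows "k = 0"
proof (rule ccontr)
  assume "k \<noteq> 0"
  then have "k \<ge> 1 \<or> k \<le> -1" by linarith
  then have "k * int n \<ge> int n \<or> k * int n \<le> - int n"
    using mult_right_mono[of 1 k "int n"] mult_right_mono[of k "-1" "int n"] by auto
  then show False using assms by linarith
qed

lemma cong_iff_shift: "[x = y] (mod int n) \<longleftrightarrow> (\<exists>k. x = y + k * int n)"
  by (metis add.commute cong_iff_lin cong_sym_eq mult.commute)

lemma Aff_cong_iff: "w \<in> Aff \<Longrightarrow> [w x = w y] (mod int n) \<longleftrightarrow> [x = y] (mod int n)"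
  by (simp add: cong_iff_shift Aff_shift [symmetric] Aff_eq_iff)

lemma Aff_inv_cong_iff: "w \<in> Aff \<Longrightarrow> [inv w x = inv w y] (mod int n) \<longleftrightarrow> [x = y] (mod int n)"
  using Aff_cong_iff[of w "inv w x" "inv w y"] by simp

text \<open>\<open>t\<close> permutes the residue classes and \<open>d\<close> depends on the class
  alone; \<open>h\<close> is \<open>t\<close> reduced to representatives in
  \<open>{1..n}\<close>.\<close>

lemma sum_over_residues:
  fixes d :: "int \<Rightarrow> int"
  assumes t: "bij t" "\<And>q k. t (q + k * int n) = t q + k * int n"
    and d: "\<And>q k. d (q + k * int n) = d q"
  shows "(\<Sum>i = 1..int n. d (t i)) = (\<Sum>i = 1..int n. d i)"
proof -
  obtain r where r: "\<And>x. 1 \<le> x + r x * int n \<and> x + r x * int n \<le> int n"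
    using residue_exists by metis
  define h where "h x = t x + r (t x) * int n" for x
  have "inj_on h {1..int n}"
  proof (rule inj_onI)
    fix x y assume x: "x \<in> {1..int n}" and y: "y \<in> {1..int n}" and "h x = h y"
    then have "t y = t x + (r (t x) - r (t y)) * int n"
      by (simp add: h_def algebra_simps)
    then have "t y = t (x + (r (t x) - r (t y)) * int n)"
      by (simp only: t(2))
    then have "y = x + (r (t x) - r (t y)) * int n"
      using t(1) by (metis bij_inv_eq_iff)
    with residue_unique[OF _ _ _ _ this] x y show "x = y" by auto
  qed
  moreover have "h ` {1..int n} \<subseteq> {1..int n}"
    using r by (auto simp: h_def)
  ultimately have "bij_betw h {1..int n} {1..int n}"
    by (simp add: bij_betw_def endo_inj_surj)
  then have "(\<Sum>i = 1..int n. d (h i)) = (\<Sum>i = 1..int n. d i)"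
    by (rule sum.reindex_bij_betw)
  then show ?thesis by (simp add: h_def d)
qed

text \<open>The normalization in the form used for products and inverses: unlike \<open>w\<close>
  itself, its displacement is periodic, so \<open>sum_over_residues\<close> applies to it.\<close>

lemma sum_displacement:
  assumes "w \<in> Aff" shows "(\<Sum>i = 1..int n. w i - i) = 0"
    and "\<And>q k. w (q + k * int n) - (q + k * int n) = w q - q"
proof -
  from assms show "(\<Sum>i = 1..int n. w i - i) = 0"
    by (simp add: sum_subtractf affine_permutations_def sum_int_interval)
  show "\<And>q k. w (q + k * int n) - (q + k * int n) = w q - q"
    using assms by (simp add: Aff_shift)
qed

lemma AffI:
  assumes "bij w" "\<And>q k. w (q + k * int n) = w q + k * int n" "(\<Sum>i = 1..int n. w i - i) = 0"
  shows "w \<in> Aff"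
proof -
  from assms show ?thesis
    by (simp add: sum_subtractf affine_permutations_def sum_int_interval)
qed

lemma id_Aff [simp]: "id \<in> Aff"
  by (rule AffI) auto

lemma comp_Aff [simp]:
  assumes "u \<in> Aff" "w \<in> Aff" shows "u \<circ> w \<in> Aff"
proof (rule AffI)
  show "bij (u \<circ> w)" using assms by (simp add: Aff_bij bij_comp)
  show "(u \<circ> w) (q + k * int n) = (u \<circ> w) q + k * int n" for q k
    using assms by (simp add: Aff_shift)
  have "(\<Sum>i = 1..int n. u (w i) - w i) = (\<Sum>i = 1..int n. u i - i)"
    using sum_over_residues[of w "\<lambda>x. u x - x"] assms
    by (simp add: Aff_bij Aff_shift)
  moreover have "(\<Sum>i = 1..int n. (u \<circ> w) i - i)
      = (\<Sum>i = 1..int n. u (w i) - w i) + (\<Sum>i = 1..int n. w i - i)"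
    by (simp add: sum.distrib [symmetric])
  ultimately show "(\<Sum>i = 1..int n. (u \<circ> w) i - i) = 0"
    using assms by (simp add: sum_displacement)
qed

lemma inv_Aff [simp]:
  assumes "w \<in> Aff" shows "inv w \<in> Aff"
proof (rule AffI)
  show "bij (inv w)" using assms by (simp add: Aff_bij bij_imp_bij_inv)
  show "inv w (q + k * int n) = inv w q + k * int n" for q k
    using assms by (rule inv_shift)
  have "(\<Sum>i = 1..int n. w (inv w i) - inv w i) = (\<Sum>i = 1..int n. w i - i)"
    using sum_over_residues[of "inv w" "\<lambda>x. w x - x"] assms
    by (simp add: Aff_bij bij_imp_bij_inv Aff_shift inv_shift)
  then have "(\<Sum>i = 1..int n. i - inv w i) = 0"
    using assms by (simp add: sum_displacement)
  then show "(\<Sum>i = 1..int n. inv w i - i) = 0"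
    by (simp add: sum_subtractf)
qed

subsection \<open>Simple reflections\<close>

lemma not_cong_Suc: "\<not> [x + 1 = x] (mod int n)"
  using n_ge_3 by (auto simp: cong_iff_dvd_diff zdvd_not_zless)

lemma srefl_lower: "[x = i] (mod int n) \<Longrightarrow> srefl i x = x + 1"
  by (simp add: simple_reflection_def)

lemma srefl_upper: "[x = i] (mod int n) \<Longrightarrow> srefl i (x + 1) = x"
proof -
  assume x: "[x = i] (mod int n)"
  then have "\<not> [x + 1 = i] (mod int n)"
    using not_cong_Suc cong_sym cong_trans by blast
  moreover have "[x + 1 = i + 1] (mod int n)"
    using x by (simp add: cong_add_rcancel)
  ultimately show ?thesis by (simp add: simple_reflection_def)
qed

lemma srefl_srefl [simp]: "srefl i (srefl i x) = x"
proof -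
  consider "[x = i] (mod int n)" | "[x - 1 = i] (mod int n)"
    | "\<not> [x = i] (mod int n)" "\<not> [x = i + 1] (mod int n)"
    by (metis cong_add_rcancel diff_add_cancel)
  then show ?thesis
  proof cases
    case 1 then show ?thesis using srefl_lower srefl_upper by simp
  next
    case 2 then show ?thesis using srefl_lower[of "x - 1"] srefl_upper[of "x - 1"] by simp
  next
    case 3 then show ?thesis by (simp add: simple_reflection_def)
  qed
qed

lemma srefl_comp_srefl [simp]: "srefl i \<circ> srefl i = id"
  by auto

lemma bij_srefl: "bij (srefl i)"
  by (rule o_bij[OF srefl_comp_srefl srefl_comp_srefl])

lemma inv_srefl [simp]: "inv (srefl i) = srefl i"
  by (rule inv_unique_comp) auto

lemma srefl_shift: "srefl i (q + k * int n) = srefl i q + k * int n"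
proof -
  have "[q + k * int n = j] (mod int n) = [q = j] (mod int n)" for j
    by (simp add: cong_def)
  then show ?thesis by (simp add: simple_reflection_def)
qed

lemma srefl_Aff [simp]: "srefl i \<in> Aff"
proof (rule AffI[OF bij_srefl srefl_shift])
  \<comment> \<open>The displacement of \<open>srefl i\<close> is this indicator of the class of
    \<open>i\<close> minus its shift by one, so it cancels over a period.\<close>
  let ?d = "\<lambda>q. if [q = i] (mod int n) then 1 else 0 :: int"
  have "(\<Sum>q = 1..int n. ?d (q - 1)) = (\<Sum>q = 1..int n. ?d q)"
  proof (rule sum_over_residues)
    show "bij (\<lambda>q::int. q - 1)" by (rule o_bij[of "\<lambda>q. q + 1"]) auto
    show "?d (q + k * int n) = ?d q" for q k by (simp add: cong_def)
  qed auto
  moreover have "srefl i q - q = ?d q - ?d (q - 1)" for q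
  proof -
    have "[q - 1 = i] (mod int n) \<longleftrightarrow> [q = i + 1] (mod int n)"
      by (metis cong_add_rcancel diff_add_cancel)
    moreover have "\<not> ([q = i] (mod int n) \<and> [q = i + 1] (mod int n))"
      using not_cong_Suc cong_sym cong_trans by blast
    ultimately show ?thesis by (auto simp: simple_reflection_def)
  qed
  ultimately show "(\<Sum>q = 1..int n. srefl i q - q) = 0"
    by (simp add: sum_subtractf)
qed

text \<open>Every integer moves by at most 1, so only neighbours can change their order.\<close>

lemma srefl_order:
  assumes "x < y" "\<not> srefl i x < srefl i y"
  shows "y = x + 1 \<and> [x = i] (mod int n)"
proof -
  have "srefl i x \<noteq> srefl i y" using assms by (metis srefl_srefl less_irrefl)
  with assms have lt: "srefl i y < srefl i x" by simp
  have b: "srefl i x \<le> x + 1" "srefl i y \<ge> y - 1" by (simp_all add: simple_reflection_def)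
  have y: "y = x + 1" using b lt assms by linarith
  show ?thesis
  proof (rule ccontr)
    assume "\<not> ?thesis"
    with y have n: "\<not> [x = i] (mod int n)" by simp
    then have "\<not> [x + 1 = i + 1] (mod int n)" by (simp add: cong_add_rcancel)
    with n y have "srefl i x \<le> x" "srefl i y \<ge> y" by (auto simp: simple_reflection_def)
    with lt assms show False by simp
  qed
qed

lemma inv_comp_srefl: "w \<in> Aff \<Longrightarrow> inv (w \<circ> srefl i) x = srefl i (inv w x)"
  by (simp add: inv_comp)

subsection \<open>Inversions\<close>

lemma inverted_shift:
  assumes "w \<in> Aff"
  shows "inverted w (x + k * int n) (y + k * int n) \<longleftrightarrow> inverted w x y"
  using assms by (simp add: inverted_def inv_shift)

lemma inverted_not_cong:
  assumes "w \<in> Aff" "inverted w x y" shows "\<not> [x = y] (mod int n)"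
  using assms by (auto simp: cong_iff_shift inverted_def inv_shift)

lemma inverted_normalize:
  assumes "x < y"
  obtains a b k where "1 \<le> a" "a \<le> n" "int a = x + k * int n" "int b = y + k * int n"
proof -
  obtain k where k: "1 \<le> x + k * int n" "x + k * int n \<le> int n"
    using residue_exists by blast
  show ?thesis
    by (rule that[of "nat (x + k * int n)" k "nat (y + k * int n)"]) (use k assms in auto)
qed

lemma Inv_subset_iff:
  assumes "u \<in> Aff" "w \<in> Aff"
  shows "I u \<subseteq> I w \<longleftrightarrow> (\<forall>x y. inverted u x y \<longrightarrow> inverted w x y)"
proof (intro iffI allI impI)
  fix x y assume sub: "I u \<subseteq> I w" and inv: "inverted u x y"
  from inv have "x < y" by (simp add: inverted_def)
  then obtain a b k
    where ab: "1 \<le> a" "a \<le> n" "int a = x + k * int n" "int b = y + k * int n"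
    by (rule inverted_normalize)
  then have "(a, b) \<in> I u" using inv assms by (simp add: mem_Inv_affine inverted_shift)
  with sub have "(a, b) \<in> I w" by blast
  then have "inverted w (int a) (int b)" by (simp add: mem_Inv_affine)
  then show "inverted w x y" using ab assms by (simp add: inverted_shift)
qed (auto simp: mem_Inv_affine)

text \<open>The displacement of \<open>inv w\<close> is periodic, hence bounded by some
  \<open>m\<close> and \<open>M\<close>; the two entries of an inversion then differ by less than
  \<open>M - m\<close>.\<close>

lemma finite_Inv:
  assumes "w \<in> Aff" shows "finite (I w)"
proof -
  define d where "d x = inv w x - x" for x
  have fin: "finite (d ` {1..int n})" by simp
  have per: "d (x + k * int n) = d x" for x k using assms by (simp add: d_def inv_shift)
  have mem: "d x \<in> d ` {1..int n}" for x
  proof -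
    obtain k where "1 \<le> x + k * int n" "x + k * int n \<le> int n" using residue_exists by blast
    then show ?thesis using per[of x k] by (metis atLeastAtMost_iff imageI)
  qed
  define m where "m = Min (d ` {1..int n})"
  define M where "M = Max (d ` {1..int n})"
  have b: "m \<le> d x" "d x \<le> M" for x
    using fin mem[of x] by (simp_all add: m_def M_def)
  have "I w \<subseteq> {..n} \<times> {..nat (int n + M - m)}"
  proof (rule subrelI)
    fix a c assume ac: "(a, c) \<in> I w"
    then have "a \<le> n" and "inverted w (int a) (int c)" by (simp_all add: mem_Inv_affine)
    then show "(a, c) \<in> {..n} \<times> {..nat (int n + M - m)}"
      using b(1)[of "int c"] b(2)[of "int a"] by (auto simp: inverted_def d_def)
  qed
  then show ?thesis by (rule finite_subset) auto
qed

lemma Inv_id [simp]: "I id = {}"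
  by (auto simp: mem_Inv_affine inverted_def)

text \<open>The displacement is weakly increasing and periodic, hence constant, and the
  normalization makes the constant 0.\<close>

lemma Aff_strict_mono_eq_id:
  assumes w: "w \<in> Aff" and step: "\<And>i. w i < w (i + 1)"
  shows "w = id"
proof -
  define d where "d x = w x - x" for x
  have per: "d (x + k * int n) = d x" for x k using w by (simp add: d_def Aff_shift)
  have mono: "d x \<le> d (x + int k)" for x k
  proof (induction k)
    case (Suc k)
    have "d (x + int k) \<le> d (x + int (Suc k))" using step[of "x + int k"] by (simp add: d_def algebra_simps)
    with Suc show ?case by linarith
  qed simp
  have const: "d x = d 0" for x
  proof -
    obtain k where k: "1 \<le> x + k * int n" using residue_exists by blast
    have 1: "d 0 \<le> d x" using mono[of 0 "nat (x + k * int n)"] k per[of x k] by simp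
    obtain l where l: "1 \<le> - x + l * int n" using residue_exists by blast
    have "d x \<le> d (0 + l * int n)" using mono[of x "nat (- x + l * int n)"] l by simp
    with 1 show ?thesis by (simp only: per)
  qed
  have "(\<Sum>i = 1..int n. d i) = 0" using sum_displacement(1)[OF w] by (simp add: d_def)
  moreover have "(\<Sum>i = 1..int n. d i) = (\<Sum>i = 1..int n. d 0)"
    by (rule sum.cong[OF refl const])
  ultimately have "d 0 = 0" using n_ge_3 by simp
  then have "w x = x" for x using const[of x] by (simp add: d_def)
  then show ?thesis by auto
qed

text \<open>A cover of the right weak order. Swapping the positions \<open>i + kn\<close> and
  \<open>i + 1 + kn\<close> changes the relative order of the translates of the pair
  \<open>w i\<close>, \<open>w (i + 1)\<close> and of no other pair; \<open>(a, b)\<close>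
  represents this class.\<close>

lemma Inv_comp_srefl:
  assumes w: "w \<in> Aff" and lt: "w i < w (i + 1)"
  obtains a b where "I (w \<circ> srefl i) = insert (a, b) (I w)" "(a, b) \<notin> I w"
    "1 \<le> a" "a \<le> n" "inv w (int b) = inv w (int a) + 1"
    "\<exists>k. int a = w i + k * int n \<and> int b = w (i + 1) + k * int n"
proof -
  obtain a b k where a: "1 \<le> a" "a \<le> n" and k: "int a = w i + k * int n" "int b = w (i + 1) + k * int n"
    using inverted_normalize[OF lt] .
  have p: "inv w (int a) = i + k * int n" "inv w (int b) = i + 1 + k * int n"
    using w by (simp_all add: k inv_shift)
  have c: "[i + k * int n = i] (mod int n)" by (simp add: cong_def)
  have p': "srefl i (inv w (int a)) = i + 1 + k * int n" "srefl i (inv w (int b)) = i + k * int n"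
    using srefl_lower[OF c] srefl_upper[OF c] unfolding p by (simp_all add: algebra_simps)
  have new: "(a, b) \<notin> I w" "(a, b) \<in> I (w \<circ> srefl i)"
    using lt k a p p' w by (auto simp: mem_Inv_affine inverted_def inv_comp_srefl simp del: o_apply)
  \<comment> \<open>A lost inversion would occupy two swapped positions, hence be a translate of the
    pair \<open>w (i + 1)\<close>, \<open>w i\<close>, which stands in increasing order in
    \<open>w\<close>.\<close>
  have "(c, d) \<in> I w \<Longrightarrow> (c, d) \<in> I (w \<circ> srefl i)" for c d
  proof (rule ccontr)
    assume cd: "(c, d) \<in> I w" "(c, d) \<notin> I (w \<circ> srefl i)"
    then have lt': "int c < int d" "inv w (int d) < inv w (int c)"
      and "\<not> srefl i (inv w (int d)) < srefl i (inv w (int c))"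
      using w by (auto simp: mem_Inv_affine inverted_def inv_comp_srefl)
    with srefl_order have "inv w (int c) = inv w (int d) + 1" "[inv w (int d) = i] (mod int n)" by blast+
    then obtain l where "inv w (int d) = i + l * int n" "inv w (int c) = (i + 1) + l * int n"
      by (auto simp: cong_iff_shift)
    then have "int d = w i + l * int n" "int c = w (i + 1) + l * int n"
      using w by (metis Aff_inv_right Aff_shift)+
    with lt lt' show False by simp
  qed
  moreover have "(c, d) = (a, b)" if cd: "(c, d) \<in> I (w \<circ> srefl i)" "(c, d) \<notin> I w" for c d
  proof -
    have lt': "int c < int d" "1 \<le> c" "c \<le> n" "inv w (int c) \<noteq> inv w (int d)"
      using cd inv_eq_iff[OF w] by (auto simp: mem_Inv_affine inverted_def)
    moreover have "\<not> inv w (int d) < inv w (int c)"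
      "srefl i (inv w (int d)) < srefl i (inv w (int c))"
      using cd w by (auto simp: mem_Inv_affine inverted_def inv_comp_srefl)
    ultimately have "inv w (int c) < inv w (int d)" "\<not> srefl i (inv w (int c)) < srefl i (inv w (int d))"
      by linarith+
    with srefl_order have "inv w (int d) = inv w (int c) + 1" "[inv w (int c) = i] (mod int n)" by blast+
    then obtain l where "inv w (int c) = i + l * int n" "inv w (int d) = (i + 1) + l * int n"
      by (auto simp: cong_iff_shift)
    then have l: "int c = w i + l * int n" "int d = w (i + 1) + l * int n"
      using w by (metis Aff_inv_right Aff_shift)+
    then have "int c = int a + (l - k) * int n" using k by (simp add: algebra_simps)
    then have "l - k = 0" using residue_unique[of "int a" "int c" "l - k"] a lt' by linarith
    with l k show ?thesis by simp
  qed
  ultimately have "I (w \<circ> srefl i) = insert (a, b) (I w)"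
    using new by (intro equalityI subrelI) blast+
  moreover have "inv w (int b) = inv w (int a) + 1" by (simp add: p)
  ultimately show ?thesis using that new(1) a k by blast
qed

subsection \<open>The weak order\<close>

text \<open>At a descent \<open>i\<close> of \<open>inv w \<circ> u\<close>, the entry
  \<open>u (i + 1)\<close> stands before \<open>u i\<close> in \<open>w\<close>. If
  \<open>u i\<close> were the larger one, \<open>u\<close> would invert this pair and
  \<open>w\<close> would not, against the inclusion. So the inversion added by
  \<open>srefl i\<close> is one of \<open>w\<close>.\<close>

lemma weak_order_step:
  assumes u: "u \<in> Aff" and w: "w \<in> Aff" and sub: "I u \<subseteq> I w" and ne: "u \<noteq> w"
  obtains i where "1 \<le> i" "i \<le> int n" "u i < u (i + 1)" "I (u \<circ> srefl i) \<subseteq> I w"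
proof -
  define v where "v = inv w \<circ> u"
  have v: "v \<in> Aff" using u w by (simp add: v_def)
  have "v \<noteq> id"
  proof
    assume "v = id"
    then have "w (inv w (u x)) = w x" for x by (simp add: v_def fun_eq_iff)
    with w ne show False by auto
  qed
  then obtain j where "\<not> v j < v (j + 1)" using Aff_strict_mono_eq_id[OF v] by blast
  moreover have "v j \<noteq> v (j + 1)" using v by (metis Aff_inv_left add_cancel_right_right zero_neq_one)
  moreover obtain k where k: "1 \<le> j + k * int n" "j + k * int n \<le> int n" using residue_exists by blast
  define i where "i = j + k * int n"
  have "v (i + 1) = v (j + 1) + k * int n"
    using Aff_shift[OF v, of "j + 1" k] by (simp add: i_def algebra_simps)
  ultimately have vi: "v (i + 1) < v i" using v by (simp add: i_def Aff_shift)
  have lt: "u i < u (i + 1)"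
  proof (rule ccontr)
    assume "\<not> ?thesis"
    moreover have "u i \<noteq> u (i + 1)" using u by (metis Aff_inv_left add_cancel_right_right zero_neq_one)
    ultimately have "inverted u (u (i + 1)) (u i)" using u by (simp add: inverted_def)
    then have "inverted w (u (i + 1)) (u i)" using sub Inv_subset_iff u w by blast
    with vi show False by (simp add: inverted_def v_def)
  qed
  obtain a b where ab: "I (u \<circ> srefl i) = insert (a, b) (I u)" "1 \<le> a" "a \<le> n"
    "\<exists>k. int a = u i + k * int n \<and> int b = u (i + 1) + k * int n"
    using Inv_comp_srefl[OF u lt] by metis
  have "inverted w (u i) (u (i + 1))" using vi lt by (simp add: inverted_def v_def)
  then have "inverted w (int a) (int b)" using ab(4) w by (auto simp: inverted_shift)
  then have "I (u \<circ> srefl i) \<subseteq> I w" using ab sub by (simp add: mem_Inv_affine)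
  with k lt that show ?thesis by (simp add: i_def)
qed

text \<open>Otherwise \<open>weak_order_step\<close> would add an inversion to \<open>I u\<close>
  and stay inside \<open>I w = I u\<close>.\<close>

lemma inj_on_Inv: "inj_on I Aff"
proof (rule inj_onI, rule ccontr)
  fix u w assume uw: "u \<in> Aff" "w \<in> Aff" "I u = I w" "u \<noteq> w"
  then obtain i where "u i < u (i + 1)" "I (u \<circ> srefl i) \<subseteq> I u"
    by (metis weak_order_step order_refl)
  with Inv_comp_srefl[OF uw(1), of i] show False by (metis insert_subset)
qed

section \<open>Words and Coxeter length\<close>

lemma word_product_Nil [simp]: "word_product n [] = id"
  and word_product_Cons: "word_product n (i # is) = srefl i \<circ> word_product n is"
  by (simp_all add: word_product_def)

lemma word_product_snoc: "word_product n (is @ [i]) = word_product n is \<circ> srefl i"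
  by (induction "is") (simp_all only: append_Nil append_Cons word_product_Nil word_product_Cons comp_assoc id_comp comp_id)

lemma word_product_Aff [simp]: "word_product n is \<in> Aff"
  by (induction "is") (simp_all only: word_product_Nil word_product_Cons comp_Aff id_Aff srefl_Aff)

lemma Inv_comp_srefl_cases:
  assumes w: "w \<in> Aff"
  shows "I w \<subseteq> I (w \<circ> srefl i) \<and> card (I (w \<circ> srefl i)) = Suc (card (I w))
    \<or> card (I (w \<circ> srefl i)) < card (I w)"
proof (cases "w i < w (i + 1)")
  case True
  then obtain a b where "I (w \<circ> srefl i) = insert (a, b) (I w)" "(a, b) \<notin> I w"
    using Inv_comp_srefl[OF w] by metis
  then show ?thesis using finite_Inv[OF w] by auto
next
  case False
  define v where "v = w \<circ> srefl i"
  have v: "v \<in> Aff" using w by (simp add: v_def)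
  have vw: "v \<circ> srefl i = w" by (simp add: v_def comp_assoc)
  have "w i \<noteq> w (i + 1)" using w by (metis Aff_inv_left add_cancel_right_right zero_neq_one)
  with False have "v i < v (i + 1)"
    using srefl_lower[of i i] srefl_upper[of i i] by (simp add: v_def)
  then obtain a b where "I w = insert (a, b) (I v)" "(a, b) \<notin> I v"
    using Inv_comp_srefl[OF v] vw by metis
  then show ?thesis using finite_Inv[OF v] by (simp add: v_def)
qed

text \<open>Each letter adds at most one inversion, so equality means that every letter added one
  and none was ever lost.\<close>

lemma card_Inv_comp_word:
  assumes u: "u \<in> Aff"
  shows "card (I (u \<circ> word_product n is)) \<le> card (I u) + length is
    \<and> (card (I (u \<circ> word_product n is)) = card (I u) + length is \<longrightarrow> I u \<subseteq> I (u \<circ> word_product n is))"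
proof (induction "is" rule: rev_induct)
  case Nil
  then show ?case by simp
next
  case (snoc i "is")
  define v where "v = u \<circ> word_product n is"
  have "v \<in> Aff" using u by (simp add: v_def)
  from Inv_comp_srefl_cases[OF this, of i] snoc show ?case
    by (auto simp: v_def word_product_snoc comp_assoc simp del: o_apply)
qed

lemma weak_order_word:
  assumes "w \<in> Aff" "u \<in> Aff" "I u \<subseteq> I w"
  obtains "is" where "is \<in> index_words n" "w = u \<circ> word_product n is"
    "card (I w) = card (I u) + length is"
proof -
  from assms have "\<exists>is. is \<in> index_words n \<and> w = u \<circ> word_product n is
    \<and> card (I w) = card (I u) + length is"
  proof (induction "card (I w) - card (I u)" arbitrary: u rule: less_induct)
    case less
    show ?case
    proof (cases "u = w")
      case True
      then show ?thesis
        by (intro exI[of _ "[]"]) (simp add: index_words_def)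
    next
      case False
      with less.prems obtain i where i: "1 \<le> i" "i \<le> int n" "u i < u (i + 1)" "I (u \<circ> srefl i) \<subseteq> I w"
        using weak_order_step by metis
      have u': "u \<circ> srefl i \<in> Aff" using less.prems by simp
      obtain a b where "I (u \<circ> srefl i) = insert (a, b) (I u)" "(a, b) \<notin> I u"
        using Inv_comp_srefl[OF less.prems(2) i(3)] by metis
      then have c: "card (I (u \<circ> srefl i)) = Suc (card (I u))"
        using finite_Inv less.prems by simp
      moreover have "card (I (u \<circ> srefl i)) \<le> card (I w)"
        using i finite_Inv less.prems by (simp add: card_mono)
      ultimately have "card (I w) - card (I (u \<circ> srefl i)) < card (I w) - card (I u)" by linarith
      then obtain "is" where "is \<in> index_words n" "w = u \<circ> srefl i \<circ> word_product n is"
        "card (I w) = card (I (u \<circ> srefl i)) + length is"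
        using less.hyps less.prems(1) u' i(4) by blast
      then show ?thesis using i c
        by (intro exI[of _ "i # is"]) (simp add: index_words_def word_product_Cons comp_assoc)
    qed
  qed
  with that show ?thesis by blast
qed

lemma coxeter_length_eq_card_Inv:
  assumes w: "w \<in> Aff" shows "coxeter_length n w = card (I w)"
  unfolding coxeter_length_def
proof (rule Least_equality)
  obtain "is" where "is \<in> index_words n" "w = id \<circ> word_product n is" "card (I w) = card (I id) + length is"
    using weak_order_word[OF w id_Aff] by auto
  then show "\<exists>is\<in>index_words n. length is = card (I w) \<and> word_product n is = w" by auto
next
  fix k assume "\<exists>is\<in>index_words n. length is = k \<and> word_product n is = w"
  then show "card (I w) \<le> k" using card_Inv_comp_word[OF id_Aff] by fastforce
qed

text \<open>Together with \<open>card_Inv_comp_eq\<close>: lengths add up in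
  \<open>u \<circ> v\<close> exactly when \<open>I u \<subseteq> I (u \<circ> v)\<close>. This is
  what turns factorizations into chains of inversion sets.\<close>

lemma card_Inv_comp_le:
  assumes "u \<in> Aff" "v \<in> Aff"
  shows "card (I (u \<circ> v)) \<le> card (I u) + card (I v)"
    and "card (I (u \<circ> v)) = card (I u) + card (I v) \<Longrightarrow> I u \<subseteq> I (u \<circ> v)"
proof -
  obtain "is" where "v = id \<circ> word_product n is" "card (I v) = card (I id) + length is"
    using weak_order_word[OF assms(2) id_Aff] by auto
  with card_Inv_comp_word[OF assms(1), of "is"]
  show "card (I (u \<circ> v)) \<le> card (I u) + card (I v)"
    "card (I (u \<circ> v)) = card (I u) + card (I v) \<Longrightarrow> I u \<subseteq> I (u \<circ> v)" by auto
qed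

lemma card_Inv_comp_eq:
  assumes "u \<in> Aff" "w \<in> Aff" "I u \<subseteq> I w"
  shows "card (I w) = card (I u) + card (I (inv u \<circ> w))"
proof -
  obtain "is" where "is": "w = u \<circ> word_product n is" "card (I w) = card (I u) + length is"
    using weak_order_word[OF assms(2,1,3)] by metis
  have v: "inv u \<circ> w = word_product n is" using assms by (auto simp: "is"(1))
  have "card (I (inv u \<circ> w)) \<le> length is"
    using card_Inv_comp_word[OF id_Aff, of "is"] v by simp
  moreover have "w = u \<circ> (inv u \<circ> w)" using assms by auto
  then have "card (I w) \<le> card (I u) + card (I (inv u \<circ> w))"
    using card_Inv_comp_le(1)[OF assms(1), of "inv u \<circ> w"] assms by simp
  ultimately show ?thesis using "is" by simp
qed

end

subsection \<open>Peeling sequences\<close>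

text \<open>
  Erasability of \<open>x\<close> in the graph that is left once the vertices of \<open>S\<close> have been peeled off, in any
  order. The inequalities take into account that the values are truncated at \<open>0\<close>.
\<close>

definition erasable_after :: "'v valued_digraph \<Rightarrow> 'v set \<Rightarrow> 'v \<Rightarrow> bool" where
  "erasable_after G S x \<longleftrightarrow>
    x \<in> pverts G - S \<and> pvalue G x \<le> card {z \<in> S. (x, z) \<in> parcs G} \<and>
    (\<forall>y. y \<notin> S \<longrightarrow> (y, x) \<in> parcs G \<longrightarrow> card {z \<in> S. (y, z) \<in> parcs G} < pvalue G y)"

text \<open>Repeated truncated decrements amount to one truncated subtraction, in which the order of
  deletion disappears. The formula is claimed for remaining vertices only: a deleted vertex has lost
  its arcs, so its value is frozen.\<close>

lemma peel_steps_take: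
  assumes "m \<le> length zs" "distinct zs" "\<forall>i < m. xs i = Some (zs ! i)"
  shows "pverts (peel_steps G xs m) = pverts G - set (take m zs)
    \<and> parcs (peel_steps G xs m)
        = {(y, z) \<in> parcs G. y \<notin> set (take m zs) \<and> z \<notin> set (take m zs)}
    \<and> (\<forall>y. y \<notin> set (take m zs) \<longrightarrow>
        pvalue (peel_steps G xs m) y = pvalue G y - card {z \<in> set (take m zs). (y, z) \<in> parcs G})"
  using assms
proof (induction m)
  case (Suc m)
  let ?S = "set (take m zs)"
  have m: "m < length zs" using Suc.prems by simp
  then have S: "set (take (Suc m) zs) = insert (zs ! m) ?S" by (simp add: take_Suc_conv_app_nth)
  have new: "zs ! m \<notin> ?S"
  proof
    assume "zs ! m \<in> ?S"
    then obtain i where "i < m" "zs ! i = zs ! m" using m by (auto simp: in_set_conv_nth)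
    with m Suc.prems(2) show False by (simp add: nth_eq_iff_index_eq)
  qed
  have c: "card {z \<in> set (take (Suc m) zs). (y, z) \<in> parcs G}
      = card {z \<in> ?S. (y, z) \<in> parcs G} + (if (y, zs ! m) \<in> parcs G then 1 else 0)" for y
  proof -
    have "{z \<in> set (take (Suc m) zs). (y, z) \<in> parcs G}
        = (if (y, zs ! m) \<in> parcs G then insert (zs ! m) {z \<in> ?S. (y, z) \<in> parcs G}
           else {z \<in> ?S. (y, z) \<in> parcs G})"
      using S by auto
    then show ?thesis using new by simp
  qed
  from Suc have "xs m = Some (zs ! m)" by simp
  with Suc.IH Suc.prems m show ?case
    unfolding c by (auto simp: S peel_def new)
qed simp

lemma erasable_peel_steps:
  assumes "m \<le> length zs" "distinct zs" "\<forall>i < m. xs i = Some (zs ! i)"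
  shows "erasable (peel_steps G xs m) x \<longleftrightarrow> erasable_after G (set (take m zs)) x"
  using peel_steps_take[OF assms, of G] unfolding erasable_def erasable_after_def by auto

text \<open>\<open>PS\<close> asks for a complete peeling sequence, so a legal beginning must be
  continued, possibly forever, by arbitrarily chosen erasable vertices.\<close>

lemma peeling_sequence_extends:
  assumes "\<And>xs m. m < length zs \<Longrightarrow> \<forall>i < m. xs i = Some (zs ! i) \<Longrightarrow> erasable (peel_steps G xs m) (zs ! m)"
  shows "\<exists>xs. peeling_sequence G xs \<and> (\<forall>i < length zs. xs i = Some (zs ! i))"
proof -
  define next_vertex where "next_vertex g i =
    (if i < length zs then Some (zs ! i)
     else if \<exists>x. erasable g x then Some (SOME x. erasable g x) else None)" for g i
  \<comment> \<open>The choice depends on the current graph, so the graphs are built by recursion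
    and the sequence is read off afterwards.\<close>
  define state where
    "state = rec_nat G (\<lambda>i g. case next_vertex g i of None \<Rightarrow> g | Some x \<Rightarrow> peel g x)"
  define xs where "xs i = next_vertex (state i) i" for i
  have steps: "peel_steps G xs i = state i" for i
    by (induction i) (simp_all add: state_def xs_def split: option.split)
  have "\<forall>i < length zs. xs i = Some (zs ! i)" by (simp add: xs_def next_vertex_def)
  moreover from this have "i < length zs \<Longrightarrow> erasable (peel_steps G xs i) (zs ! i)" for i
    using assms by simp
  then have "peeling_sequence G xs"
    unfolding peeling_sequence_def steps xs_def
    by (auto simp: next_vertex_def split: option.splits if_splits intro: someI)
  ultimately show ?thesis by blast
qed

lemma PS_iff_erasable_after:
  "zs \<in> PS G A \<longleftrightarrow> distinct zs \<and> set zs = A \<and>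
    (\<forall>j < length zs. erasable_after G (set (take j zs)) (zs ! j))"
proof
  assume "zs \<in> PS G A"
  then obtain xs where zs: "distinct zs" "set zs = A" and xs: "peeling_sequence G xs"
    "\<forall>i < length zs. xs i = Some (zs ! i)" by (auto simp: PS_def)
  have "erasable_after G (set (take j zs)) (zs ! j)" if "j < length zs" for j
  proof -
    have "erasable (peel_steps G xs j) (zs ! j)"
      using xs that by (auto simp: peeling_sequence_def split: option.splits)
    then show ?thesis using erasable_peel_steps[of j zs xs G] zs xs that by simp
  qed
  with zs show "distinct zs \<and> set zs = A \<and>
    (\<forall>j < length zs. erasable_after G (set (take j zs)) (zs ! j))" by simp
next
  assume *: "distinct zs \<and> set zs = A \<and>
    (\<forall>j < length zs. erasable_after G (set (take j zs)) (zs ! j))"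
  then have "\<exists>xs. peeling_sequence G xs \<and> (\<forall>i < length zs. xs i = Some (zs ! i))"
    using erasable_peel_steps[of _ zs _ G] by (intro peeling_sequence_extends) simp
  with * show "zs \<in> PS G A" by (simp add: PS_def)
qed

context affine_type
begin

section \<open>Entries between two others in value and in position\<close>

definition gap :: "(int \<Rightarrow> int) \<Rightarrow> int \<Rightarrow> int \<Rightarrow> int \<Rightarrow> bool" where
  "gap u x y k \<longleftrightarrow> x < k \<and> k < y \<and> inv u x < inv u k \<and> inv u k < inv u y"

text \<open>The reflection \<open>k \<mapsto> x + y - k\<close> sends \<open>x + jn\<close> to
  \<open>y - jn\<close>; by periodicity it reverses the positions in the same way.\<close>

lemma gap_reflect:
  assumes "u \<in> Aff" and "gap u x y (x + j * int n)"
  shows "gap u x y (y - j * int n)"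
  using assms inv_shift[of u y "- j"] by (auto simp: gap_def inv_shift)

text \<open>A gap congruent to \<open>x\<close> reflects to one congruent to \<open>y\<close>. So
  the values, which count only gaps incongruent to the first entry, nevertheless detect every
  gap.\<close>

lemma gap_not_cong_left:
  assumes u: "u \<in> Aff" and xy: "\<not> [x = y] (mod int n)" and k: "gap u x y k"
  obtains k' where "gap u x y k'" "\<not> [k' = x] (mod int n)"
proof (cases "[k = x] (mod int n)")
  case True
  then obtain j where "k = x + j * int n" by (auto simp: cong_iff_shift)
  then have "gap u x y (y - j * int n)" using gap_reflect u k by simp
  moreover have "[y - j * int n = y] (mod int n)" by (simp add: cong_def mod_diff_right_eq [symmetric])
  with xy have "\<not> [y - j * int n = x] (mod int n)" by (metis cong_def)
  ultimately show ?thesis using that by blast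
qed (use k that in blast)

lemma gap_not_cong_right:
  assumes u: "u \<in> Aff" and xy: "\<not> [x = y] (mod int n)" and k: "gap u x y k"
  obtains k' where "gap u x y k'" "\<not> [k' = y] (mod int n)"
proof (cases "[k = y] (mod int n)")
  case True
  then obtain j where "k = y + j * int n" by (auto simp: cong_iff_shift)
  then have "gap u x y (x - j * int n)"
    using k inv_shift[OF u, of y j] inv_shift[OF u, of x "- j"] by (auto simp: gap_def)
  moreover have "[x - j * int n = x] (mod int n)" by (simp add: cong_def mod_diff_right_eq [symmetric])
  with xy have "\<not> [x - j * int n = y] (mod int n)" by (metis cong_def)
  ultimately show ?thesis using that by blast
qed (use k that in blast)

text \<open>
  Here \<open>n \<ge> 3\<close> is essential: the two positions following \<open>inv u x\<close> and the one of \<open>x\<close> are pairwise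
  incongruent, so one of these two holds an entry congruent neither to \<open>x\<close> nor to \<open>y\<close>.
\<close>

lemma adjacent_positions:
  assumes u: "u \<in> Aff" and xy: "x < y" "inv u x < inv u y" "\<not> [x = y] (mod int n)"
    and none: "\<And>k. \<not> gap u x y k"
    and above: "\<And>y'. y < y' \<Longrightarrow> \<not> [x = y'] (mod int n) \<Longrightarrow> inv u x < inv u y' \<Longrightarrow> \<exists>k. gap u x y' k"
    and below: "\<And>x'. x' < x \<Longrightarrow> \<not> [x' = y] (mod int n) \<Longrightarrow> inv u x' < inv u y \<Longrightarrow> \<exists>k. gap u x' y k"
  shows "inv u y = inv u x + 1"
proof -
  define between where "between z \<longleftrightarrow> inv u x < inv u z \<and> inv u z < inv u y" for z
  \<comment> \<open>Descent on \<open>z - y\<close>: the pair \<open>(x, z)\<close> has a gap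
    incongruent to \<open>x\<close>; it also stands between the positions of \<open>x\<close> and
    \<open>y\<close>, so by \<open>none\<close> it cannot lie below \<open>y\<close> and is a
    smaller counterexample above \<open>y\<close>.\<close>
  have up: False if z: "y < z" "\<not> [x = z] (mod int n)" "between z" for z
    using z
  proof (induction "nat (z - y)" arbitrary: z rule: less_induct)
    case less
    then obtain k where "gap u x z k" using above by (auto simp: between_def)
    with less.prems obtain k where k: "gap u x z k" "\<not> [k = x] (mod int n)"
      using gap_not_cong_left[OF u] by blast
    then have b: "between k" using less.prems by (auto simp: between_def gap_def)
    with none[of k] k have "\<not> k < y" by (auto simp: between_def gap_def)
    moreover have "k \<noteq> y" using b by (auto simp: between_def)
    ultimately have "y < k" by simp
    with less.hyps[of k] b k show False by (auto simp: gap_def cong_sym_eq)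
  qed
  have down: False if z: "z < x" "\<not> [z = y] (mod int n)" "between z" for z
    using z
  proof (induction "nat (x - z)" arbitrary: z rule: less_induct)
    case less
    then obtain k where "gap u z y k" using below by (auto simp: between_def)
    with less.prems obtain k where k: "gap u z y k" "\<not> [k = y] (mod int n)"
      using gap_not_cong_right[OF u] by blast
    then have b: "between k" using less.prems by (auto simp: between_def gap_def)
    with none[of k] k have "\<not> x < k" by (auto simp: between_def gap_def)
    moreover have "k \<noteq> x" using b by (auto simp: between_def)
    ultimately have "k < x" by simp
    with less.hyps[of k] b k show False by (auto simp: gap_def cong_sym_eq)
  qed
  have outside: "z < x \<or> y < z" if "between z" for z
  proof -
    have "z \<noteq> x" "z \<noteq> y" using that by (auto simp: between_def)
    with none[of z] that show ?thesis by (auto simp: between_def gap_def)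
  qed
  have small: "\<not> [c + r = c] (mod int n)" if "r = 1 \<or> r = 2" for c r :: int
    using that n_ge_3 by (auto simp: cong_iff_dvd_diff zdvd_not_zless)
  have res: "[z = t] (mod int n) \<longleftrightarrow> [inv u z = inv u t] (mod int n)" for z t
    using u by (simp add: Aff_inv_cong_iff)
  show ?thesis
  proof (rule ccontr)
    assume "inv u y \<noteq> inv u x + 1"
    with xy have lt: "inv u x + 1 < inv u y" by simp
    \<comment> \<open>The entry directly after \<open>x\<close>. It is incongruent to
      \<open>x\<close>, so \<open>up\<close> puts it below \<open>x\<close>, and then
      \<open>down\<close> makes it congruent to \<open>y\<close>; hence \<open>y\<close> stands at
      least \<open>n\<close> positions after \<open>z\<close>.\<close>
    define z where "z = u (inv u x + 1)"
    have pz: "inv u z = inv u x + 1" using u by (simp add: z_def)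
    have bz: "between z" using lt by (simp add: between_def pz)
    have "\<not> [x = z] (mod int n)"
    proof
      assume "[x = z] (mod int n)"
      then have "[z = x] (mod int n)" by (rule cong_sym)
      with small[of 1 "inv u x"] res[of z x] show False by (simp add: pz)
    qed
    with up outside bz have "z < x" by blast
    with down bz have zy: "[z = y] (mod int n)" by blast
    then obtain j where j: "inv u y = inv u z + j * int n"
      using res by (metis cong_iff_shift cong_sym)
    with lt pz have "0 < j * int n" by simp
    then have "1 \<le> j" using zero_less_mult_pos2[of j "int n"] n_ge_3 by simp
    then have "int n \<le> j * int n" using mult_right_mono[of 1 j "int n"] by simp
    \<comment> \<open>Since \<open>n \<ge> 3\<close>, the next position still comes before that of
      \<open>y\<close>. Its entry is incongruent to \<open>x\<close> and to \<open>z\<close>, hence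
      to \<open>y\<close>, and neither side is left for it.\<close>
    define t where "t = u (inv u x + 2)"
    have pt: "inv u t = inv u x + 2" using u by (simp add: t_def)
    have bt: "between t"
      unfolding between_def pt using \<open>int n \<le> j * int n\<close> n_ge_3 j pz by linarith
    have "\<not> [x = t] (mod int n)"
    proof
      assume "[x = t] (mod int n)"
      then have "[t = x] (mod int n)" by (rule cong_sym)
      with small[of 2 "inv u x"] res[of t x] show False by (simp add: pt)
    qed
    moreover have "\<not> [t = z] (mod int n)"
      using small[of 1 "inv u x + 1"] res[of t z] by (simp add: pt pz add.commute)
    with zy have "\<not> [t = y] (mod int n)" by (metis cong_def)
    ultimately show False using outside[OF bt] up down bt by blast
  qed
qed

lemma cong_int_nat: "[int a = int b] (mod int n) \<longleftrightarrow> [a = b] (mod n)"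
  by (rule cong_int_iff)

lemma Inv_subset_lambda: "u \<in> Aff \<Longrightarrow> I u \<subseteq> lambda_cyl n"
  using inverted_not_cong[of u "int a" "int b" for a b]
  by (fastforce simp: lambda_cyl_def mem_Inv_affine inverted_def cong_int_nat cong_sym_eq[of _ _ n])

text \<open>
  For \<open>k \<equiv> a\<close> the hook element represented by \<open>(k, b)\<close> is also of the form \<open>(a, k')\<close>. So the hook
  elements are indexed without repetition if the pairs \<open>(k, b)\<close> with \<open>k \<equiv> a\<close> are left out.
\<close>

lemma theta_eq:
  assumes u: "u \<in> Aff" and ab: "(a, b) \<in> lambda_cyl n" "(a, b) \<notin> I u"
  shows "theta_cyl n (a, b) = card {z \<in> I u. z \<in> hook_cyl n (a, b)}
    + card {k. gap u (int a) (int b) (int k) \<and> \<not> [k = a] (mod n)}"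
proof -
  let ?p = "\<lambda>x. inv u (int x)"
  define K where "K = {k. a < k \<and> k < b \<and> \<not> [k = a] (mod n)}"
  have fin: "finite K" by (rule finite_subset[of _ "{..b}"]) (auto simp: K_def)
  from ab have a: "1 \<le> a" "a \<le> n" "a < b" "\<not> [b = a] (mod n)" by (auto simp: lambda_cyl_def)
  have "?p a \<noteq> ?p b" using inv_eq_iff[OF u] a by simp
  with ab a have lt: "?p a < ?p b" by (auto simp: mem_Inv_affine inverted_def)
  \<comment> \<open>The entries counted by \<open>theta_cyl\<close> are split by position: before
    \<open>a\<close>, so that \<open>(a, k)\<close> is inverted; between \<open>a\<close> and
    \<open>b\<close>, the gaps; after \<open>b\<close>, so that \<open>(k, b)\<close> is
    inverted.\<close>
  define L where "L = {k \<in> K. ?p k < ?p a}"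
  define M where "M = {k \<in> K. gap u (int a) (int b) (int k)}"
  define R where "R = {k \<in> K. ?p b < ?p k}"
  have "K = L \<union> M \<union> R"
  proof -
    have "?p k \<noteq> ?p a" "?p k \<noteq> ?p b" if "k \<in> K" for k
      using that inv_eq_iff[OF u] by (auto simp: K_def)
    then show ?thesis by (force simp: L_def M_def R_def gap_def K_def)
  qed
  moreover have "L \<inter> M = {}" "(L \<union> M) \<inter> R = {}"
    using lt by (auto simp: L_def M_def R_def gap_def)
  moreover have "finite L" "finite M" "finite R"
    using fin by (simp_all add: L_def M_def R_def)
  ultimately have cK: "card K = card L + card M + card R"
    by (metis card_Un_disjoint finite_UnI)
  have "{(a', k) \<in> lambda_cyl n. a' = a \<and> a < k \<and> k < b} = Pair a ` K"
    using a by (auto simp: lambda_cyl_def K_def)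
  then have theta: "theta_cyl n (a, b) = card K"
    by (simp add: theta_cyl_def card_image inj_on_def)
  \<comment> \<open>The peeled part of the hook, split to match: \<open>H1\<close> corresponds to
    \<open>L\<close> and \<open>H2\<close> to \<open>R\<close>.\<close>
  define H1 where "H1 = {z \<in> I u. z \<in> hook_cyl n (a, b) \<and> fst z = a}"
  define H2 where "H2 = {z \<in> I u. z \<in> hook_cyl n (a, b) \<and> fst z \<noteq> a}"
  have "H1 = Pair a ` L"
  proof (intro equalityI subsetI)
    fix z assume z: "z \<in> H1"
    then obtain k where k: "z = (a, k)" and inv: "inverted u (int a) (int k)" and h: "(a, k) \<in> hook_cyl n (a, b)"
      by (cases z) (auto simp: H1_def mem_Inv_affine)
    have nc: "\<not> [k = a] (mod n)" using inverted_not_cong[OF u inv] by (simp add: cong_int_nat cong_sym_eq)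
    \<comment> \<open>For \<open>k \<ge> b\<close> only the second part of the hook with
      \<open>q = b\<close> is possible, and its bound would read \<open>a < a\<close>.\<close>
    have "k < b"
    proof (rule ccontr)
      assume "\<not> k < b"
      with h show False by (auto simp: hook_cyl_def)
    qed
    with nc inv k show "z \<in> Pair a ` L" by (auto simp: L_def K_def inverted_def)
  next
    fix z assume "z \<in> Pair a ` L"
    then show "z \<in> H1" using a
      by (auto simp: H1_def L_def K_def mem_Inv_affine inverted_def hook_cyl_def lambda_cyl_def)
  qed
  then have cH1: "card H1 = card L" by (simp add: card_image inj_on_def)
  \<comment> \<open>Undoes the normalization: \<open>(k, q)\<close> represents the pair
    \<open>(k + (b - q), b)\<close>, and \<open>g\<close> returns the first entry of that
    pair.\<close>
  define g where "g = (\<lambda>(k, q). k + (b - q))"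
  have H2: "1 \<le> k \<and> k \<le> n \<and> k \<noteq> a \<and> inverted u (int k) (int q) \<and> q \<le> b \<and> [q = b] (mod n)
      \<and> a < k + (b - q) \<and> k + (b - q) < b \<and> (\<exists>j. int b = int q + j * int n)" if z: "(k, q) \<in> H2" for k q
  proof -
    have 1: "q \<le> b" "[q = b] (mod n)" using z by (auto simp: H2_def hook_cyl_def)
    then have "\<exists>j. int b = int q + j * int n" by (metis cong_iff_shift cong_int_nat cong_sym)
    with z 1 show ?thesis by (auto simp: H2_def hook_cyl_def mem_Inv_affine)
  qed
  have "bij_betw g H2 R"
    unfolding bij_betw_def
  proof (intro conjI equalityI subsetI)
    show "inj_on g H2"
    proof (rule inj_onI)
      fix y z assume y: "y \<in> H2" and z: "z \<in> H2" and e: "g y = g z"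
      obtain k q k' q' where yz: "y = (k, q)" "z = (k', q')" by (cases y, cases z)
      obtain i where i: "int b = int q + i * int n" using H2 y yz by blast
      obtain j where j: "int b = int q' + j * int n" using H2 z yz by blast
      have b: "1 \<le> k" "k \<le> n" "1 \<le> k'" "k' \<le> n" "q \<le> b" "q' \<le> b"
        using H2 y z yz by blast+
      have "int k + (int b - int q) = int k' + (int b - int q')"
        using e b by (simp add: g_def yz)
      with i j have *: "int k' = int k + (i - j) * int n" by (simp add: algebra_simps)
      then have "i - j = 0" using residue_unique[OF _ _ _ _ *] b by simp
      with * i j show "y = z" by (simp add: yz)
    qed
    fix x assume "x \<in> g ` H2"
    then obtain k q where kq: "(k, q) \<in> H2" "x = k + (b - q)" by (auto simp: g_def)
    obtain j where j: "int b = int q + j * int n" using H2 kq by blast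
    have b: "1 \<le> k" "k \<le> n" "k \<noteq> a" "q \<le> b" "inverted u (int k) (int q)" "a < x" "x < b" using H2 kq by blast+
    have x: "int x = int k + j * int n" using kq j b by simp
    have "\<not> [x = a] (mod n)"
    proof
      assume "[x = a] (mod n)"
      then obtain i where "int x = int a + i * int n" by (metis cong_iff_shift cong_int_nat)
      then have *: "int a = int k + (j - i) * int n" using x by (simp add: algebra_simps)
      then have "j - i = 0" using residue_unique[OF _ _ _ _ *] a b by simp
      with * b show False by simp
    qed
    moreover have "?p b < ?p x"
      using b(5) j x u by (simp add: inverted_def inv_shift)
    ultimately show "x \<in> R" using b by (simp add: R_def K_def)
  next
    fix x assume "x \<in> R"
    then have x: "a < x" "x < b" "\<not> [x = a] (mod n)" "?p b < ?p x" by (auto simp: R_def K_def)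
    then obtain k q j where kq: "1 \<le> k" "k \<le> n" "int k = int x + j * int n" "int q = int b + j * int n"
      using inverted_normalize[of "int x" "int b"] by (metis of_nat_less_iff)
    \<comment> \<open>As \<open>x\<close> is positive, normalizing can only move
      \<open>(x, b)\<close> downwards, which gives the bound \<open>q \<le> b\<close> of the
      hook.\<close>
    have "j \<le> 0"
    proof (rule ccontr)
      assume "\<not> j \<le> 0"
      then have "int n \<le> j * int n" using mult_right_mono[of 1 j "int n"] by simp
      with kq x a show False by linarith
    qed
    then have jn: "j * int n \<le> 0" by (simp add: mult_nonpos_nonneg)
    have qb: "q \<le> b" using jn kq by linarith
    have xk: "x = k + (b - q)" using kq qb by linarith
    have inv: "inverted u (int k) (int q)" using x kq u by (simp add: inverted_def inv_shift)
    then have I: "(k, q) \<in> I u" using kq by (simp add: mem_Inv_affine)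
    have qc: "[q = b] (mod n)" using kq by (metis cong_iff_shift cong_int_nat)
    have "k \<noteq> a"
    proof
      assume "k = a"
      with kq(3) have "[int a = int x] (mod int n)" by (metis cong_iff_shift)
      with x(3) show False by (simp add: cong_int_nat cong_sym_eq)
    qed
    moreover have "(k, q) \<in> hook_cyl n (a, b)"
      using Inv_subset_lambda[OF u] I qb qc xk x by (auto simp: hook_cyl_def)
    ultimately show "x \<in> g ` H2" using I xk by (force simp: H2_def g_def)
  qed
  then have cH2: "card H2 = card R" by (rule bij_betw_same_card)
  have "{z \<in> I u. z \<in> hook_cyl n (a, b)} = H1 \<union> H2" by (auto simp: H1_def H2_def)
  moreover have "finite H1" "finite H2" using finite_Inv[OF u] by (simp_all add: H1_def H2_def)
  moreover have "H1 \<inter> H2 = {}" by (auto simp: H1_def H2_def)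
  ultimately have "card {z \<in> I u. z \<in> hook_cyl n (a, b)} = card H1 + card H2"
    by (simp add: card_Un_disjoint)
  moreover have "{k. gap u (int a) (int b) (int k) \<and> \<not> [k = a] (mod n)} = M"
    by (auto simp: M_def K_def gap_def)
  ultimately show ?thesis using cK theta cH1 cH2 by simp
qed

text \<open>By \<open>theta_eq\<close> the inequality says that no gap is incongruent to
  \<open>a\<close>, and by \<open>gap_not_cong_left\<close> there is then no gap at all.\<close>

lemma theta_le_iff_no_gap:
  assumes u: "u \<in> Aff" and ab: "(a, b) \<in> lambda_cyl n" "(a, b) \<notin> I u"
  shows "theta_cyl n (a, b) \<le> card {z \<in> I u. ((a, b), z) \<in> parcs (affine_digraph n)}
    \<longleftrightarrow> (\<forall>k. \<not> gap u (int a) (int b) k)"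
proof -
  let ?M = "{k. gap u (int a) (int b) (int k) \<and> \<not> [k = a] (mod n)}"
  have "(a, b) \<notin> hook_cyl n (a, b)" by (auto simp: hook_cyl_def)
  then have "{z \<in> I u. ((a, b), z) \<in> parcs (affine_digraph n)} = {z \<in> I u. z \<in> hook_cyl n (a, b)}"
    using ab Inv_subset_lambda[OF u] by (auto simp: affine_digraph_def)
  moreover have "finite ?M"
    by (rule finite_subset[of _ "{..b}"]) (auto simp: gap_def)
  moreover have "?M = {} \<longleftrightarrow> (\<forall>k. \<not> gap u (int a) (int b) k)"
  proof
    assume M: "?M = {}"
    show "\<forall>k. \<not> gap u (int a) (int b) k"
    proof (intro allI notI)
      fix k assume k: "gap u (int a) (int b) k"
      have "\<not> [int a = int b] (mod int n)"
        using ab by (auto simp: lambda_cyl_def cong_int_nat cong_sym_eq)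
      from gap_not_cong_left[OF u this k] obtain k where
        k: "gap u (int a) (int b) k" "\<not> [k = int a] (mod int n)" by blast
      then have "k = int (nat k)" by (simp add: gap_def)
      with k have "nat k \<in> ?M" by (metis (mono_tags, lifting) cong_int_nat mem_Collect_eq)
      with M show False by blast
    qed
  qed auto
  ultimately show ?thesis using theta_eq[OF assms] by (simp add: card_eq_0_iff)
qed

text \<open>The arcs into \<open>(a, b)\<close> from remaining vertices supply the assumptions
  \<open>above\<close> and \<open>below\<close> of \<open>adjacent_positions\<close>. Conversely,
  adjacent positions leave no room for a gap, and if \<open>(a, b)\<close> lies in the hook of a
  remaining \<open>(c, d)\<close>, then \<open>b\<close> or a translate of \<open>a\<close> is a gap
  of \<open>(c, d)\<close>.\<close>

lemma erasable_after_iff_adjacent: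
  assumes u: "u \<in> Aff"
  shows "erasable_after (affine_digraph n) (I u) (a, b) \<longleftrightarrow>
    (a, b) \<in> lambda_cyl n \<and> inv u (int b) = inv u (int a) + 1"
proof
  assume e: "erasable_after (affine_digraph n) (I u) (a, b)"
  then have ab: "(a, b) \<in> lambda_cyl n" "(a, b) \<notin> I u"
    and "theta_cyl n (a, b) \<le> card {z \<in> I u. ((a, b), z) \<in> parcs (affine_digraph n)}"
    by (auto simp: erasable_after_def affine_digraph_def)
  then have none: "\<not> gap u (int a) (int b) k" for k using theta_le_iff_no_gap[OF u ab] by blast
  have other: "\<exists>k. gap u (int c) (int d) k"
    if "(c, d) \<in> lambda_cyl n" "(c, d) \<notin> I u" "(c, d) \<noteq> (a, b)" "(a, b) \<in> hook_cyl n (c, d)" for c d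
  proof -
    have "((c, d), (a, b)) \<in> parcs (affine_digraph n)" using that ab by (simp add: affine_digraph_def)
    with e that(2) have "card {z \<in> I u. ((c, d), z) \<in> parcs (affine_digraph n)} < theta_cyl n (c, d)"
      by (auto simp: erasable_after_def affine_digraph_def)
    with theta_le_iff_no_gap[OF u that(1,2)] show ?thesis by auto
  qed
  from ab have a: "1 \<le> a" "a \<le> n" "a < b" "\<not> [b = a] (mod n)" by (auto simp: lambda_cyl_def)
  have "inv u (int b) = inv u (int a) + 1"
  proof (rule adjacent_positions[OF u _ _ _ none])
    show "int a < int b" using a by simp
    have "inv u (int a) \<noteq> inv u (int b)" using inv_eq_iff[OF u] a by simp
    then show "inv u (int a) < inv u (int b)" using ab a by (auto simp: mem_Inv_affine inverted_def)
    show "\<not> [int a = int b] (mod int n)" using a by (simp add: cong_int_nat cong_sym_eq)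
  next
    fix y' assume y: "int b < y'" "\<not> [int a = y'] (mod int n)" "inv u (int a) < inv u y'"
    define d where "d = nat y'"
    have d: "y' = int d" using y by (simp add: d_def)
    have "(a, d) \<in> lambda_cyl n" using y a by (auto simp: lambda_cyl_def d cong_int_nat cong_sym_eq)
    moreover have "(a, d) \<notin> I u" using y by (auto simp: d mem_Inv_affine inverted_def)
    moreover have "(a, b) \<in> hook_cyl n (a, d)" using y ab a by (auto simp: d hook_cyl_def)
    ultimately show "\<exists>k. gap u (int a) y' k" using other[of a d] y by (auto simp: d)
  next
    fix x' assume x: "x' < int a" "\<not> [x' = int b] (mod int n)" "inv u x' < inv u (int b)"
    then obtain c d j where cd: "1 \<le> c" "c \<le> n" "int c = x' + j * int n" "int d = int b + j * int n"
      using inverted_normalize[of x' "int b"] a by (metis less_trans of_nat_less_iff)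
    \<comment> \<open>Since \<open>x' < a \<le> n\<close>, a downward shift would take
      \<open>c\<close> below 1. So \<open>b \<le> d\<close>, and \<open>(a, b)\<close> is the
      representative of \<open>(a + (d - b), d)\<close> in the hook of
      \<open>(c, d)\<close>.\<close>
    have "0 \<le> j"
    proof (rule ccontr)
      assume "\<not> 0 \<le> j"
      then have "j * int n \<le> - int n" using mult_right_mono[of j "-1" "int n"] by simp
      with cd x a show False by linarith
    qed
    then have jn: "0 \<le> j * int n" by simp
    have bd: "b \<le> d" using cd jn by linarith
    have cc: "c < a + (d - b)" "a + (d - b) < d" "c < d" using cd jn x a bd by linarith+
    have "[d = b] (mod n)" using cd by (metis cong_iff_shift cong_int_nat)
    then have bq: "[b = d] (mod n)" by (rule cong_sym)
    have nc: "\<not> [d = c] (mod n)"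
    proof
      assume "[d = c] (mod n)"
      with bq have "[b = c] (mod n)" by (rule cong_trans)
      then have "[int c = int b] (mod int n)" by (simp add: cong_int_nat cong_sym_eq)
      moreover have "[int c = x'] (mod int n)" using cd cong_iff_shift by blast
      ultimately show False using x by (metis cong_def)
    qed
    then have l: "(c, d) \<in> lambda_cyl n" using cd cc by (auto simp: lambda_cyl_def)
    have "\<not> inverted u (int c) (int d)" using x cd u by (simp add: inverted_def inv_shift)
    then have "(c, d) \<notin> I u" by (simp add: mem_Inv_affine)
    moreover have "(a, b) \<in> hook_cyl n (c, d)"
      using ab bd bq cc by (auto simp: hook_cyl_def)
    moreover have "(c, d) \<noteq> (a, b)" using cc cd x by auto
    ultimately obtain k where k: "gap u (int c) (int d) k" using other[OF l] by blast
    then have "gap u x' (int b) (k + - j * int n)"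
      using cd inv_shift[OF u, of x' j] inv_shift[OF u, of "int b" j] inv_shift[OF u, of k "- j"]
      by (auto simp: gap_def)
    then show "\<exists>k. gap u x' (int b) k" by blast
  qed
  with ab show "(a, b) \<in> lambda_cyl n \<and> inv u (int b) = inv u (int a) + 1" by simp
next
  assume ab: "(a, b) \<in> lambda_cyl n \<and> inv u (int b) = inv u (int a) + 1"
  then have notI: "(a, b) \<notin> I u" by (auto simp: mem_Inv_affine inverted_def)
  have "\<not> gap u (int a) (int b) k" for k using ab by (auto simp: gap_def)
  then have "theta_cyl n (a, b) \<le> card {z \<in> I u. ((a, b), z) \<in> parcs (affine_digraph n)}"
    using theta_le_iff_no_gap[OF u] ab notI by blast
  moreover have "card {z \<in> I u. (y, z) \<in> parcs (affine_digraph n)} < theta_cyl n y"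
    if y: "y \<notin> I u" "(y, (a, b)) \<in> parcs (affine_digraph n)" for y
  proof -
    obtain c d where cd: "y = (c, d)" by (cases y)
    have l: "(c, d) \<in> lambda_cyl n" and h: "(a, b) \<in> hook_cyl n (c, d)"
      using y by (auto simp: affine_digraph_def cd)
    then have c: "1 \<le> c" "c \<le> n" "c < d" by (auto simp: lambda_cyl_def)
    have ne: "inv u (int c) < inv u (int d)"
      using inv_eq_iff[OF u, of "int c" "int d"] c y by (auto simp: cd mem_Inv_affine inverted_def)
    from h consider "a = c" "c < b" "b < d"
      | "b \<le> d" "[b = d] (mod n)" "c < a + (d - b)" "a + (d - b) < d"
      by (auto simp: hook_cyl_def)
    then have "\<exists>k. gap u (int c) (int d) k"
    proof cases
      case 1
      have "inv u (int b) \<noteq> inv u (int d)" using inv_eq_iff[OF u] 1 by simp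
      then have "gap u (int c) (int d) (int b)" using 1 ab ne by (auto simp: gap_def)
      then show ?thesis by blast
    next
      case 2
      obtain j where j: "int d = int b + j * int n"
        using 2(2) by (metis cong_iff_shift cong_int_nat cong_sym)
      define k where "k = int a + j * int n"
      have k: "int c < k" "k < int d" using 2 j by (auto simp: k_def)
      have "inv u (int d) = inv u k + 1" using ab u by (simp add: j k_def inv_shift)
      moreover have "inv u k \<noteq> inv u (int c)" using inv_eq_iff[OF u] k by simp
      ultimately have "gap u (int c) (int d) k" using k ne by (auto simp: gap_def)
      then show ?thesis by blast
    qed
    with theta_le_iff_no_gap[OF u l] y show ?thesis by (auto simp: cd)
  qed
  ultimately show "erasable_after (affine_digraph n) (I u) (a, b)"
    using ab notI by (auto simp: erasable_after_def affine_digraph_def)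
qed

text \<open>For the converse direction: two inversion sets that differ by one element are joined by
  a weak order step, and the pair that it adds must be that element, which is therefore in adjacent
  positions.\<close>

lemma PS_iff_Inv:
  "zs \<in> PS (affine_digraph n) A \<longleftrightarrow>
    distinct zs \<and> set zs = A \<and> (\<forall>j \<le> length zs. set (take j zs) \<in> I ` Aff)"
proof
  assume zs: "zs \<in> PS (affine_digraph n) A"
  then have d: "distinct zs" "set zs = A"
    and e: "\<And>j. j < length zs \<Longrightarrow> erasable_after (affine_digraph n) (set (take j zs)) (zs ! j)"
    by (auto simp: PS_iff_erasable_after)
  have "j \<le> length zs \<Longrightarrow> set (take j zs) \<in> I ` Aff" for j
  proof (induction j)
    case 0
    have "I id \<in> I ` Aff" by (rule imageI) (rule id_Aff)
    then show ?case by simp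
  next
    case (Suc j)
    then obtain u where u: "u \<in> Aff" "set (take j zs) = I u" by auto
    obtain a b where ab: "zs ! j = (a, b)" by (cases "zs ! j")
    have l: "(a, b) \<in> lambda_cyl n" and p: "inv u (int b) = inv u (int a) + 1"
      using e[of j] Suc.prems u ab erasable_after_iff_adjacent by auto
    define i where "i = inv u (int a)"
    have i: "u i = int a" "u (i + 1) = int b" using u p by (simp_all add: i_def flip: p)
    have "u i < u (i + 1)" using l by (simp add: i lambda_cyl_def)
    from Inv_comp_srefl[OF u(1) this] obtain a' b' where ab': "I (u \<circ> srefl i) = insert (a', b') (I u)"
      "1 \<le> a'" "a' \<le> n" "\<exists>k. int a' = u i + k * int n \<and> int b' = u (i + 1) + k * int n" by metis
    then obtain k where k: "int a' = int a + k * int n" "int b' = int b + k * int n" using i by auto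
    \<comment> \<open>The new inversion is known up to translation; both first components lie in
      \<open>{1..n}\<close>, so it is \<open>(a, b)\<close> itself.\<close>
    have "k = 0" using residue_unique[OF _ _ _ _ k(1)] l ab' by (auto simp: lambda_cyl_def)
    with k ab' have "I (u \<circ> srefl i) = insert (a, b) (I u)" by simp
    moreover have "set (take (Suc j) zs) = insert (a, b) (I u)"
      using Suc.prems u ab by (simp add: take_Suc_conv_app_nth)
    ultimately have "set (take (Suc j) zs) = I (u \<circ> srefl i)" by simp
    with u show ?case by (metis comp_Aff imageI srefl_Aff)
  qed
  with d show "distinct zs \<and> set zs = A \<and> (\<forall>j \<le> length zs. set (take j zs) \<in> I ` Aff)" by simp
next
  assume zs: "distinct zs \<and> set zs = A \<and> (\<forall>j \<le> length zs. set (take j zs) \<in> I ` Aff)"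
  have "erasable_after (affine_digraph n) (set (take j zs)) (zs ! j)" if j: "j < length zs" for j
  proof -
    obtain u where u: "u \<in> Aff" "set (take j zs) = I u"
    proof -
      have "set (take j zs) \<in> I ` Aff" using zs j by simp
      then show ?thesis using that by blast
    qed
    obtain w where w: "w \<in> Aff" "set (take (Suc j) zs) = I w"
    proof -
      have "set (take (Suc j) zs) \<in> I ` Aff" using zs j by (metis Suc_leI)
      then show ?thesis using that by blast
    qed
    have Iw: "I w = insert (zs ! j) (I u)" using u w j by (simp add: take_Suc_conv_app_nth)
    have "zs ! j \<notin> I u"
    proof
      assume "zs ! j \<in> I u"
      then obtain i where "i < j" "zs ! i = zs ! j" using j by (auto simp: in_set_conv_nth u(2) [symmetric])
      with j zs show False by (simp add: nth_eq_iff_index_eq)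
    qed
    with Iw have "u \<noteq> w" by auto
    with Iw u w obtain i where i: "u i < u (i + 1)" "I (u \<circ> srefl i) \<subseteq> I w"
      by (metis weak_order_step subset_insertI)
    from Inv_comp_srefl[OF u(1) i(1)] obtain a b where ab: "I (u \<circ> srefl i) = insert (a, b) (I u)"
      "(a, b) \<notin> I u" "inv u (int b) = inv u (int a) + 1" by metis
    have "zs ! j = (a, b)" using ab i(2) Iw by auto
    moreover have "(a, b) \<in> lambda_cyl n"
      using Inv_subset_lambda[OF w(1)] ab i(2) by auto
    ultimately show ?thesis using erasable_after_iff_adjacent[OF u(1)] ab u by simp
  qed
  with zs show "zs \<in> PS (affine_digraph n) A" by (simp add: PS_iff_erasable_after)
qed

subsection \<open>Cyclically decreasing elements\<close>

text \<open>All entries of the affine inversion code, the number of \<open>y\<close> with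
  \<open>inverted v x y\<close> for each \<open>x\<close>, are at most 1.\<close>

definition thin :: "(int \<Rightarrow> int) \<Rightarrow> bool" where
  "thin v \<longleftrightarrow> (\<forall>x y y'. inverted v x y \<longrightarrow> inverted v x y' \<longrightarrow> y = y')"

text \<open>The order of \<open>x\<close> and \<open>y\<close> survives the relabelling: if
  \<open>u\<close> reversed it, then \<open>u\<close>, hence \<open>w\<close>, would invert
  \<open>u y\<close> and \<open>u x\<close>, and the quotient would not invert \<open>x\<close> and
  \<open>y\<close>.\<close>

lemma inverted_quotient:
  assumes u: "u \<in> Aff" and w: "w \<in> Aff" and sub: "I u \<subseteq> I w"
  shows "inverted (inv u \<circ> w) x y \<longleftrightarrow> inverted w (u x) (u y) \<and> \<not> inverted u (u x) (u y)"
proof -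
  have i: "inv (inv u \<circ> w) z = inv w (u z)" for z
    using u w by (simp add: inv_comp Aff_bij inv_inv_eq)
  have "u x < u y" if "x < y" "inv w (u y) < inv w (u x)"
  proof (rule ccontr)
    assume "\<not> u x < u y"
    moreover have "u x \<noteq> u y" using that Aff_eq_iff[OF u] by simp
    ultimately have "inverted u (u y) (u x)" using that u by (simp add: inverted_def)
    then have "inverted w (u y) (u x)" using Inv_subset_iff[OF u w] sub by blast
    with that show False by (simp add: inverted_def)
  qed
  moreover have "x \<noteq> y" if "u x < u y" using that by auto
  ultimately show ?thesis using u by (auto simp: inverted_def i)
qed

lemma thin_quotient_iff:
  assumes u: "u \<in> Aff" and w: "w \<in> Aff" and sub: "I u \<subseteq> I w"
  shows "thin (inv u \<circ> w) \<longleftrightarrow>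
    (\<forall>a b b'. (a, b) \<in> I w - I u \<longrightarrow> (a, b') \<in> I w - I u \<longrightarrow> b = b')"
proof (intro iffI allI impI)
  fix a b b' assume thin: "thin (inv u \<circ> w)" and b: "(a, b) \<in> I w - I u" "(a, b') \<in> I w - I u"
  have "inverted (inv u \<circ> w) (inv u (int a)) (inv u (int c))" if "(a, c) \<in> I w - I u" for c
    using that u by (auto simp: inverted_quotient[OF assms] mem_Inv_affine)
  with thin b have "inv u (int b) = inv u (int b')" by (auto simp: thin_def)
  then show "b = b'" using inv_eq_iff[OF u] by simp
next
  assume *: "\<forall>a b b'. (a, b) \<in> I w - I u \<longrightarrow> (a, b') \<in> I w - I u \<longrightarrow> b = b'"
  show "thin (inv u \<circ> w)"
    unfolding thin_def
  proof (intro allI impI)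
    fix x y y' assume "inverted (inv u \<circ> w) x y" "inverted (inv u \<circ> w) x y'"
    then have inv: "inverted w (u x) (u y)" "\<not> inverted u (u x) (u y)"
      "inverted w (u x) (u y')" "\<not> inverted u (u x) (u y')"
      by (simp_all add: inverted_quotient[OF assms])
    from inv(1) have "u x < u y" by (simp add: inverted_def)
    then obtain a b k where ab: "1 \<le> a" "a \<le> n" "int a = u x + k * int n" "int b = u y + k * int n"
      by (rule inverted_normalize)
    define b' where "b' = nat (u y' + k * int n)"
    have b': "int b' = u y' + k * int n" using inv(3) ab by (simp add: b'_def inverted_def)
    have "(a, b) \<in> I w - I u" "(a, b') \<in> I w - I u"
      using inv ab b' u w by (simp_all add: mem_Inv_affine inverted_shift)
    with * have "b = b'" by blast
    with ab b' show "y = y'" using Aff_eq_iff[OF u] by simp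
  qed
qed

lemma thin_iff:
  assumes "v \<in> Aff"
  shows "thin v \<longleftrightarrow> (\<forall>a b b'. (a, b) \<in> I v \<longrightarrow> (a, b') \<in> I v \<longrightarrow> b = b')"
proof -
  have "inv id \<circ> v = v" by simp
  with thin_quotient_iff[OF id_Aff assms] show ?thesis by (simp del: o_apply inv_id)
qed

section \<open>Words of cyclically decreasing elements\<close>

lemma word_product_fixes:
  assumes "\<forall>i \<in> set is. \<not> [i = j] (mod int n) \<and> \<not> [i = j - 1] (mod int n)"
  shows "word_product n is j = j" and "j < q \<Longrightarrow> j < word_product n is q"
    and "q < j \<Longrightarrow> word_product n is q < j"
proof -
  have "word_product n is j = j \<and> (\<forall>q. j < q \<longrightarrow> j < word_product n is q) \<and>
    (\<forall>q. q < j \<longrightarrow> word_product n is q < j)"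
    using assms
  proof (induction "is")
    case (Cons i "is")
    have ni: "\<not> [j = i] (mod int n)" "\<not> [j = i + 1] (mod int n)"
    proof -
      show "\<not> [j = i] (mod int n)" using Cons.prems by (auto dest: cong_sym)
      show "\<not> [j = i + 1] (mod int n)"
      proof
        assume "[j = i + 1] (mod int n)"
        then have "[i + 1 = (j - 1) + 1] (mod int n)" by (simp add: cong_sym)
        then have "[i = j - 1] (mod int n)" by (simp only: cong_add_rcancel)
        with Cons.prems show False by simp
      qed
    qed
    have fix_j: "srefl i j = j" using ni by (simp add: simple_reflection_def)
    have ne: "srefl i q \<noteq> j" if "q \<noteq> j" for q using that fix_j by (metis srefl_srefl)
    \<comment> \<open>A letter moves \<open>q\<close> by at most 1 and not onto \<open>j\<close>, so
      no entry crosses \<open>j\<close>.\<close>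
    have "srefl i q \<ge> q - 1" "srefl i q \<le> q + 1" for q by (simp_all add: simple_reflection_def)
    then have "j < q \<Longrightarrow> j < srefl i q" "q < j \<Longrightarrow> srefl i q < j" for q
      using ne[of q] by (smt (verit))+
    with fix_j Cons show ?case by (simp add: word_product_Cons)
  qed simp
  then show "word_product n is j = j" "j < q \<Longrightarrow> j < word_product n is q"
    "q < j \<Longrightarrow> word_product n is q < j" by blast+
qed

lemma cong_eq_letter:
  assumes "[i = j] (mod int n)" "i \<in> {1..int n}" "j \<in> {1..int n}" shows "i = j"
proof -
  obtain k where k: "i = j + k * int n" using assms(1) cong_iff_shift by blast
  then have "k = 0" using residue_unique[OF _ _ _ _ k] assms by simp
  with k show ?thesis by simp
qed

lemma cong_Suc_iff_pred: "[j = i + 1] (mod int n) \<longleftrightarrow> [i = j - 1] (mod int n)"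
  by (metis cong_add_rcancel cong_sym diff_add_cancel)

text \<open>Before a last letter \<open>j\<close>, the letter \<open>j + 1\<close> is allowed but
  \<open>j - 1\<close> is not, so the preceding word fixes \<open>j\<close>. For this reason the
  inductions split words at the end.\<close>

lemma cyclically_decreasing_word_snoc:
  "cyclically_decreasing_word n (is @ [j]) \<longleftrightarrow>
    cyclically_decreasing_word n is \<and> j \<in> {1..int n} \<and>
    (\<forall>i \<in> set is. \<not> [i = j] (mod int n) \<and> \<not> [i = j - 1] (mod int n))"
  (is "?L \<longleftrightarrow> ?R")
proof
  assume L: ?L
  have c: "q < p" if "p < Suc (length is)" "q < Suc (length is)"
    "[(is @ [j]) ! q = (is @ [j]) ! p + 1] (mod int n)" for p q
    using L that by (simp add: cyclically_decreasing_word_def)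
  have j: "j \<in> {1..int n}" "set is \<subseteq> {1..int n}" "distinct is" "j \<notin> set is"
    using L by (auto simp: cyclically_decreasing_word_def index_words_def)
  have "q < p" if "p < length is" "q < length is" "[is ! q = is ! p + 1] (mod int n)" for p q
    using c[of p q] that by (simp add: nth_append)
  then have "cyclically_decreasing_word n is"
    using j by (auto simp: cyclically_decreasing_word_def index_words_def)
  moreover have "\<not> [i = j] (mod int n) \<and> \<not> [i = j - 1] (mod int n)" if i: "i \<in> set is" for i
  proof
    show "\<not> [i = j] (mod int n)" using cong_eq_letter i j by blast
    obtain p where p: "p < length is" "is ! p = i" using i by (auto simp: in_set_conv_nth)
    show "\<not> [i = j - 1] (mod int n)"
      using c[of p "length is"] p by (auto simp: nth_append cong_Suc_iff_pred [symmetric])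
  qed
  ultimately show ?R using j by blast
next
  assume R: ?R
  then have "distinct (is @ [j])" "is @ [j] \<in> index_words n"
    by (auto simp: cyclically_decreasing_word_def index_words_def)
  moreover have "q < p" if pq: "p < length (is @ [j])" "q < length (is @ [j])"
    and c: "[(is @ [j]) ! q = (is @ [j]) ! p + 1] (mod int n)" for p q
  proof (cases "q < length is")
    case True
    then show ?thesis using R pq c by (cases "p < length is") (auto simp: nth_append cyclically_decreasing_word_def)
  next
    case False
    with pq have q: "q = length is" by simp
    show ?thesis
    proof (cases "p < length is")
      case True
      then have "[is ! p = j - 1] (mod int n)" using c q by (simp add: nth_append cong_Suc_iff_pred)
      with R True show ?thesis by simp
    next
      case False
      with pq c q have "[j = j + 1] (mod int n)" by (simp add: nth_append less_Suc_eq)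
      with not_cong_Suc[of j] show ?thesis by (auto dest: cong_sym)
    qed
  qed
  ultimately show ?L by (simp add: cyclically_decreasing_word_def)
qed

text \<open>The preceding word fixes \<open>j\<close> and lets nothing cross it, so \<open>j\<close>
  is not yet the smaller entry of an inversion; the inversion added by the last letter has smaller
  entry \<open>j\<close>.\<close>

lemma thin_word_product:
  "cyclically_decreasing_word n is \<Longrightarrow> thin (word_product n is)"
proof (induction "is" rule: rev_induct)
  case Nil
  show ?case by (simp add: thin_def inverted_def)
next
  case (snoc j "is")
  let ?v = "word_product n is"
  have v: "?v \<in> Aff" by simp
  from snoc.prems have "cyclically_decreasing_word n is" and j: "j \<in> {1..int n}"
    and "\<forall>i \<in> set is. \<not> [i = j] (mod int n) \<and> \<not> [i = j - 1] (mod int n)"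
    by (simp_all add: cyclically_decreasing_word_snoc)
  then have thin: "thin ?v" and fixes_j: "?v j = j"
    and above: "\<And>q. j < q \<Longrightarrow> j < ?v q" and below: "\<And>q. q < j \<Longrightarrow> ?v q < j"
    using snoc.IH word_product_fixes by blast+
  have "?v j < ?v (j + 1)" using above fixes_j by simp
  from Inv_comp_srefl[OF v this] obtain a b where ab: "I (?v \<circ> srefl j) = insert (a, b) (I ?v)"
    "1 \<le> a" "a \<le> n" "\<exists>k. int a = ?v j + k * int n" by metis
  then have "[int a = j] (mod int n)" by (auto simp: cong_iff_shift fixes_j)
  then have a: "int a = j" using ab j by (intro cong_eq_letter) auto
  have "(a, c) \<notin> I ?v" for c
  proof
    assume "(a, c) \<in> I ?v"
    then have c: "j < int c" "inv ?v (int c) < inv ?v j" by (simp_all add: mem_Inv_affine inverted_def a)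
    have "inv ?v j = j" using Aff_inv_left[OF v, of j] by (simp add: fixes_j)
    with c(2) have "?v (inv ?v (int c)) < j" by (intro below) simp
    with c(1) Aff_inv_right[OF v] show False by simp
  qed
  then show ?case
    using thin ab(1) by (auto simp: thin_iff word_product_snoc simp del: o_apply)
qed

text \<open>Take the entry of \<open>{1..n}\<close> in the leftmost position. A larger entry above
  \<open>n\<close> is an upward translate of one in \<open>{1..n}\<close> and stands even further to
  the right.\<close>

lemma no_inversion_exists:
  assumes v: "v \<in> Aff"
  obtains x where "1 \<le> x" "x \<le> int n" "\<And>y. \<not> inverted v x y"
proof -
  have "\<exists>x. is_arg_min (inv v) (\<lambda>x. x \<in> {1..int n}) x"
    using n_ge_3 by (intro ex_is_arg_min_if_finite) auto
  then obtain x where x: "x \<in> {1..int n}" "\<And>z. z \<in> {1..int n} \<Longrightarrow> \<not> inv v z < inv v x"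
    by (auto simp: is_arg_min_def)
  have "\<not> inverted v x y" for y
  proof
    assume "inverted v x y"
    then have y: "x < y" "inv v y < inv v x" by (simp_all add: inverted_def)
    obtain k where k: "1 \<le> y + k * int n" "y + k * int n \<le> int n" using residue_exists by blast
    then have "\<not> inv v y + k * int n < inv v x" using x(2)[of "y + k * int n"] v by (simp add: inv_shift)
    with y have "0 < k * int n" by linarith
    then have "1 \<le> k" using zero_less_mult_pos2[of k "int n"] n_ge_3 by simp
    then have "int n \<le> k * int n" using mult_right_mono[of 1 k "int n"] by simp
    with k x y show False by simp
  qed
  with x that show ?thesis by auto
qed

text \<open>Provides the last letter of the word to be constructed: \<open>j\<close> must occur in
  it, while \<open>j - 1\<close> must not.\<close>

lemma first_inverted_entry:
  assumes v: "v \<in> Aff" and ne: "I v \<noteq> {}"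
  obtains j b where "1 \<le> j" "j \<le> n" "(j, b) \<in> I v" "\<And>y. \<not> inverted v (int j - 1) y"
proof -
  obtain x where x: "1 \<le> x" "x \<le> int n" "\<And>y. \<not> inverted v x y"
    using no_inversion_exists[OF v] by blast
  obtain a c where ac: "1 \<le> a" "a \<le> n" "inverted v (int a) (int c)" using ne by (auto simp: mem_Inv_affine)
  \<comment> \<open>Shifted below 1, so that the search upwards from \<open>x'\<close> meets
    \<open>a\<close>; the least hit is not \<open>x'\<close> itself and thus has a predecessor
    without inversions.\<close>
  define x' where "x' = x - int n"
  have x': "\<not> inverted v x' y" for y
    using x(3)[of "y + 1 * int n"] inverted_shift[OF v, of x' 1 y] by (simp add: x'_def)
  define P where "P k \<longleftrightarrow> (\<exists>y. inverted v (x' + int k) y)" for k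
  have "x' + int (nat (int a - x')) = int a" using x ac by (simp add: x'_def)
  then have "P (nat (int a - x'))" using ac by (auto simp: P_def)
  then have PL: "P (LEAST k. P k)" by (rule LeastI)
  then have "(LEAST k. P k) \<noteq> 0" using x' by (auto simp: P_def intro: Nat.gr0I)
  then obtain m where m: "(LEAST k. P k) = Suc m" using not0_implies_Suc by blast
  then have "\<not> P m" by (metis lessI not_less_Least)
  then have none: "\<not> inverted v (x' + int m) y" for y by (simp add: P_def)
  obtain y where y: "inverted v (x' + int (Suc m)) y" using PL m by (auto simp: P_def)
  then have "x' + int (Suc m) < y" by (simp add: inverted_def)
  then obtain j b k where j: "1 \<le> j" "j \<le> n" "int j = x' + int (Suc m) + k * int n" "int b = y + k * int n"
    by (rule inverted_normalize)
  have "(j, b) \<in> I v" using y j v by (simp add: mem_Inv_affine inverted_shift del: of_nat_Suc)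
  moreover have "\<not> inverted v (int j - 1) z" for z
    using none[of "z + - k * int n"] inverted_shift[OF v, of "int j - 1" "- k" z] j(3)
    by (simp add: algebra_simps)
  ultimately show ?thesis using that j by blast
qed

text \<open>The letter \<open>j\<close> of \<open>first_inverted_entry\<close> is split off at the
  end: \<open>b\<close> stands directly before \<open>j\<close>, and swapping them removes the
  inversion \<open>(j, b)\<close> alone. The clause on letters strengthens the induction: it shows
  that the word of the rest avoids \<open>j\<close> and \<open>j - 1\<close>.\<close>

lemma thin_imp_word:
  assumes "v \<in> Aff" "thin v"
  shows "\<exists>is. cyclically_decreasing_word n is \<and> word_product n is = v \<and> length is = card (I v)
    \<and> (\<forall>i \<in> set is. \<exists>y. inverted v i y)"
  using assms
proof (induction "card (I v)" arbitrary: v rule: less_induct)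
  case less
  note v = less.prems(1) and thin = less.prems(2)
  show ?case
  proof (cases "I v = {}")
    case True
    then have "v = id" using inj_onD[OF inj_on_Inv _ v id_Aff] by simp
    then show ?thesis
      by (intro exI[of _ "[]"]) (simp add: cyclically_decreasing_word_def index_words_def)
  next
    case False
    obtain j b where j: "1 \<le> j" "j \<le> n" "(j, b) \<in> I v" "\<And>y. \<not> inverted v (int j - 1) y"
      using first_inverted_entry[OF v False] by metis
    then have jb: "inverted v (int j) (int b)" by (simp add: mem_Inv_affine)
    then have lt: "int j < int b" "inv v (int b) < inv v (int j)" by (simp_all add: inverted_def)
    define i where "i = inv v (int b)"
    have vi: "v i = int b" using v by (simp add: i_def)
    have pj: "inv v (int j) = i + 1"
    proof (rule ccontr)
      assume "inv v (int j) \<noteq> i + 1"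
      \<comment> \<open>An entry \<open>z\<close> between \<open>b\<close> and \<open>j\<close>
        gives two inversions with the same smaller entry: \<open>j\<close> with \<open>b\<close> and
        \<open>z\<close> if \<open>z > j\<close>, and otherwise \<open>z\<close> with
        \<open>b\<close> and \<open>j - 1\<close>, because \<open>j - 1\<close> stands before
        \<open>b\<close>.\<close>
      define z where "z = v (i + 1)"
      have pz: "inv v z = i + 1" using v by (simp add: z_def)
      with \<open>inv v (int j) \<noteq> i + 1\<close> lt have z: "inv v (int b) < inv v z" "inv v z < inv v (int j)"
        by (simp_all add: i_def)
      then have ne: "z \<noteq> int j" "z \<noteq> int b" by auto
      show False
      proof (cases "int j < z")
        case True
        then have "inverted v (int j) z" using z by (simp add: inverted_def)
        with thin jb ne show False by (auto simp: thin_def)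
      next
        case False
        then have zj: "z < int j" using ne by simp
        then have zb: "inverted v z (int b)" using z lt by (simp add: inverted_def)
        then have "z \<noteq> int j - 1" using j(4) by auto
        moreover have "inv v (int j - 1) \<le> inv v (int b)" using j(4)[of "int b"] lt by (simp add: inverted_def)
        ultimately have "inverted v z (int j - 1)" using z zj by (simp add: inverted_def)
        with zb thin have "int b = int j - 1" by (auto simp: thin_def)
        with lt show False by simp
      qed
    qed
    then have vi1: "v (i + 1) = int j" using Aff_inv_right[OF v, of "int j"] by simp
    define u where "u = v \<circ> srefl i"
    have u: "u \<in> Aff" using v by (simp add: u_def)
    have ui: "u i = int j" "u (i + 1) = int b"
      using srefl_lower[of i i] srefl_upper[of i i] by (simp_all add: u_def vi vi1)
    have uv: "u \<circ> srefl i = v" by (simp add: u_def comp_assoc)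
    have "u i < u (i + 1)" using lt ui by simp
    from Inv_comp_srefl[OF u this] obtain c d where cd: "I v = insert (c, d) (I u)" "(c, d) \<notin> I u"
      "1 \<le> c" "c \<le> n" "\<exists>k. int c = int j + k * int n \<and> int d = int b + k * int n"
      unfolding uv ui by metis
    then obtain k where k: "int c = int j + k * int n" "int d = int b + k * int n" by blast
    have "k = 0" using residue_unique[OF _ _ _ _ k(1)] cd j by simp
    with k cd have Iv: "I v = insert (j, b) (I u)" "(j, b) \<notin> I u" by simp_all
    have thin_u: "thin u" using thin Iv(1) unfolding thin_iff[OF u] thin_iff[OF v] by blast
    have card: "card (I v) = Suc (card (I u))" using Iv finite_Inv[OF u] by simp
    have uv_inv: "inverted v x y" if "inverted u x y" for x y
      using that Inv_subset_iff[OF u v] Iv by blast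
    have "\<not> inverted u (int j) y" for y
    proof
      assume inv: "inverted u (int j) y"
      then have y: "y = int (nat y)" by (simp add: inverted_def)
      with inv have "(j, nat y) \<in> I u" using j by (simp add: mem_Inv_affine)
      with Iv thin thin_iff[OF v] show False by blast
    qed
    moreover have "\<not> inverted u (int j - 1) y" for y using uv_inv j(4) by blast
    moreover have "\<exists>y. inverted u m y" if "[l = m] (mod int n)" "inverted u l y" for l m y
    proof -
      obtain k where "l = m + k * int n" using \<open>[l = m] (mod int n)\<close> cong_iff_shift by blast
      then have "inverted u m (y - k * int n)"
        using that inverted_shift[OF u, of m k "y - k * int n"] by simp
      then show ?thesis by blast
    qed
    ultimately have avoid: "\<not> [l = int j] (mod int n) \<and> \<not> [l = int j - 1] (mod int n)"
      if "inverted u l y" for l y using that by blast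
    obtain "is" where "is": "cyclically_decreasing_word n is" "word_product n is = u"
      "length is = card (I u)" "\<forall>i \<in> set is. \<exists>y. inverted u i y"
      using less.hyps[OF _ u thin_u] card by auto
    then have away: "\<forall>i \<in> set is. \<not> [i = int j] (mod int n) \<and> \<not> [i = int j - 1] (mod int n)"
      using avoid by blast
    \<comment> \<open>The entry \<open>j\<close> is at position \<open>i\<close> of \<open>u\<close>
      and is fixed by \<open>u\<close>, so the swap at \<open>i\<close> is the letter
      \<open>j\<close>.\<close>
    then have "u (int j) = int j" using word_product_fixes(1)[of "is" "int j"] "is" by simp
    with ui have i: "i = int j" using Aff_eq_iff[OF u] by metis
    have "cyclically_decreasing_word n (is @ [int j])"
      using away "is" j by (simp add: cyclically_decreasing_word_snoc)
    moreover have "word_product n (is @ [int j]) = v"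
      using "is" i uv by (simp add: word_product_snoc)
    moreover have "\<forall>i \<in> set is. \<exists>y. inverted v i y"
      using "is"(4) uv_inv by blast
    then have "\<forall>i \<in> set (is @ [int j]). \<exists>y. inverted v i y"
      using jb by auto
    ultimately show ?thesis using "is" card
      by (intro exI[of _ "is @ [int j]"]) simp
  qed
qed

lemma cyclically_decreasing_iff_thin:
  "v \<in> cyclically_decreasing n \<longleftrightarrow> v \<in> Aff \<and> thin v"
proof
  assume "v \<in> cyclically_decreasing n"
  then show "v \<in> Aff \<and> thin v"
    using thin_word_product by (auto simp: cyclically_decreasing_def reduced_decompositions_def)
next
  assume v: "v \<in> Aff \<and> thin v"
  then obtain "is" where "is": "cyclically_decreasing_word n is" "word_product n is = v" "length is = card (I v)"
    using thin_imp_word by blast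
  then have "is \<in> reduced_decompositions n v"
    using v by (simp add: reduced_decompositions_def coxeter_length_eq_card_Inv cyclically_decreasing_word_def)
  with "is" v show "v \<in> cyclically_decreasing n" by (auto simp: cyclically_decreasing_def)
qed

subsection \<open>Semi-standard fillings\<close>

text \<open>Refines one level of a filling to single peeling steps.\<close>

lemma weak_order_enumeration:
  assumes "u \<in> Aff" "w \<in> Aff" "I u \<subseteq> I w"
  shows "\<exists>cs. distinct cs \<and> set cs = I w - I u \<and> (\<forall>j \<le> length cs. I u \<union> set (take j cs) \<in> I ` Aff)"
  using assms
proof (induction "card (I w) - card (I u)" arbitrary: u rule: less_induct)
  case less
  show ?case
  proof (cases "u = w")
    case True
    with less.prems show ?thesis by (intro exI[of _ "[]"]) simp
  next
    case False
    obtain i where i: "u i < u (i + 1)" "I (u \<circ> srefl i) \<subseteq> I w"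
      using weak_order_step[OF less.prems False] by metis
    obtain a b where ab: "I (u \<circ> srefl i) = insert (a, b) (I u)" "(a, b) \<notin> I u"
      using Inv_comp_srefl[OF less.prems(1) i(1)] by metis
    have u': "u \<circ> srefl i \<in> Aff" using less.prems by simp
    have "card (I (u \<circ> srefl i)) = Suc (card (I u))" using ab finite_Inv less.prems by simp
    moreover have "card (I (u \<circ> srefl i)) \<le> card (I w)" using i finite_Inv less.prems by (simp add: card_mono)
    ultimately have "card (I w) - card (I (u \<circ> srefl i)) < card (I w) - card (I u)" by linarith
    then obtain cs where cs: "distinct cs" "set cs = I w - insert (a, b) (I u)"
      "\<forall>j \<le> length cs. insert (a, b) (I u) \<union> set (take j cs) \<in> I ` Aff"
      using less.hyps[OF _ u' less.prems(2) i(2)] unfolding ab by blast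
    show ?thesis
    proof (intro exI[of _ "(a, b) # cs"] conjI allI impI)
      show "distinct ((a, b) # cs)" using cs by simp
      show "set ((a, b) # cs) = I w - I u" using cs ab i by auto
      fix j assume "j \<le> length ((a, b) # cs)"
      then show "I u \<union> set (take j ((a, b) # cs)) \<in> I ` Aff"
        using cs less.prems by (cases j) auto
    qed
  qed
qed

text \<open>Along a semi-standard enumeration \<open>f\<close> increases weakly, so its sublevel
  sets are prefixes; conversely, peeling orders of the successive levels are concatenated. On
  inversions \<open>U_col\<close> is symmetric, so strictness merely forbids equal first components
  within a level, whatever order is chosen there.\<close>

lemma semi_standard_iff:
  assumes w: "w \<in> Aff" and f: "\<forall>z \<in> I w. 1 \<le> f z"
  shows "semi_standard (affine_digraph n) (I w) (U_col n) f \<longleftrightarrow>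
    (\<forall>i. {z \<in> I w. f z \<le> i} \<in> I ` Aff) \<and>
    (\<forall>a b b'. (a, b) \<in> I w \<longrightarrow> (a, b') \<in> I w \<longrightarrow> f (a, b) = f (a, b') \<longrightarrow> b = b')"
proof -
  have col: "(a', b') \<in> U_col n (a, b) \<longleftrightarrow> a' = a" if "(a', b') \<in> I w" for a a' b b'
    using that Inv_subset_lambda[OF w] by (auto simp: U_col_def lambda_cyl_def)
  show ?thesis
  proof (intro iffI conjI allI impI)
    assume "semi_standard (affine_digraph n) (I w) (U_col n) f"
    then obtain zs where "zs \<in> PS (affine_digraph n) (I w)" and mono: "\<And>i j. i < j \<Longrightarrow> j < length zs \<Longrightarrow>
        f (zs ! i) \<le> f (zs ! j) \<and> (zs ! j \<in> U_col n (zs ! i) \<longrightarrow> f (zs ! i) < f (zs ! j))"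
      unfolding semi_standard_def by blast
    then have zs: "distinct zs" "set zs = I w" "\<And>j. j \<le> length zs \<Longrightarrow> set (take j zs) \<in> I ` Aff"
      by (simp_all add: PS_iff_Inv)
    {
      fix i
      have "sorted (map f zs)" using mono by (auto simp: sorted_iff_nth_mono_less)
      then have "{z \<in> set zs. f z \<le> i} = set (takeWhile (\<lambda>z. f z \<le> i) zs)"
      proof (induction zs)
        case (Cons z zs)
        show ?case
        proof (cases "f z \<le> i")
          case True
          with Cons show ?thesis by auto
        next
          case False
          with Cons.prems show ?thesis by force
        qed
      qed simp
      also have "\<dots> = set (take (length (takeWhile (\<lambda>z. f z \<le> i) zs)) zs)"
        by (simp add: takeWhile_eq_take [symmetric])
      also have "\<dots> \<in> I ` Aff" by (rule zs(3)) (rule length_takeWhile_le)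
      finally show "{z \<in> I w. f z \<le> i} \<in> I ` Aff" by (simp add: zs)
    }
    {
      fix a b b' assume b: "(a, b) \<in> I w" "(a, b') \<in> I w" "f (a, b) = f (a, b')"
      have "i = j" if "i < length zs" "j < length zs" "zs ! i = (a, c)" "zs ! j = (a, d)"
        "f (a, c) = f (a, d)" "(a, c) \<in> I w" "(a, d) \<in> I w" for i j c d
        using mono[of i j] mono[of j i] that col by (metis less_irrefl linorder_neqE_nat)
      with b show "b = b'" unfolding zs(2) [symmetric] in_set_conv_nth by (metis prod.inject)
    }
  next
    assume *: "(\<forall>i. {z \<in> I w. f z \<le> i} \<in> I ` Aff) \<and>
      (\<forall>a b b'. (a, b) \<in> I w \<longrightarrow> (a, b') \<in> I w \<longrightarrow> f (a, b) = f (a, b') \<longrightarrow> b = b')"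
    have prefix: "\<exists>u \<in> Aff. I u = {z \<in> I w. f z \<le> i}" for i
    proof -
      from * have "{z \<in> I w. f z \<le> i} \<in> I ` Aff" by blast
      then obtain u where "{z \<in> I w. f z \<le> i} = I u" "u \<in> Aff" by (rule imageE)
      then show ?thesis by (intro bexI[of _ u]) (rule sym)
    qed
    have "\<exists>zs. distinct zs \<and> set zs = {z \<in> I w. f z \<le> i} \<and> sorted (map f zs)
        \<and> (\<forall>j \<le> length zs. set (take j zs) \<in> I ` Aff)" for i
    proof (induction i)
      case 0
      \<comment> \<open>Fillings start at 1, so level 0 is the inversion set of
        \<open>id\<close>.\<close>
      have "{z \<in> I w. f z \<le> 0} = {}" using f by force
      moreover have "{} \<in> I ` Aff" using id_Aff Inv_id by (metis image_eqI)
      ultimately show ?case by (intro exI[of _ "[]"]) simp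
    next
      case (Suc i)
      then obtain zs where zs: "distinct zs" "set zs = {z \<in> I w. f z \<le> i}" "sorted (map f zs)"
        "\<forall>j \<le> length zs. set (take j zs) \<in> I ` Aff" by blast
      obtain u where u: "u \<in> Aff" "I u = {z \<in> I w. f z \<le> i}" using prefix by blast
      obtain u' where u': "u' \<in> Aff" "I u' = {z \<in> I w. f z \<le> Suc i}" using prefix by blast
      have "I u \<subseteq> I u'" using u u' by auto
      then obtain cs where cs: "distinct cs" "set cs = I u' - I u"
        "\<forall>j \<le> length cs. I u \<union> set (take j cs) \<in> I ` Aff"
        using weak_order_enumeration[OF u(1) u'(1)] by blast
      have level: "f z = Suc i" if "z \<in> set cs" for z using that cs u u' by auto
      show ?case
      proof (intro exI[of _ "zs @ cs"] conjI allI impI)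
        show "distinct (zs @ cs)" using zs cs u by auto
        show "set (zs @ cs) = {z \<in> I w. f z \<le> Suc i}" using zs cs u u' by auto
        have "sorted (map f cs)"
          using level by (auto simp: sorted_iff_nth_mono_less)
        then show "sorted (map f (zs @ cs))"
          using zs level by (auto simp: sorted_append)
        fix j assume j: "j \<le> length (zs @ cs)"
        show "set (take j (zs @ cs)) \<in> I ` Aff"
        proof (cases "j \<le> length zs")
          case True
          then show ?thesis using zs by simp
        next
          case False
          then have "set (take j (zs @ cs)) = I u \<union> set (take (j - length zs) cs)" by (simp add: zs u)
          also have "\<dots> \<in> I ` Aff" using cs(3) j by auto
          finally show ?thesis .
        qed
      qed
    qed
    then obtain zs where zs: "distinct zs" "set zs = {z \<in> I w. f z \<le> Max (f ` I w)}" "sorted (map f zs)"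
      "\<forall>j \<le> length zs. set (take j zs) \<in> I ` Aff" by blast
    \<comment> \<open>For empty \<open>I w\<close> the maximum is unspecified, but the bound is
      asked of members only.\<close>
    have "f z \<le> Max (f ` I w)" if "z \<in> I w" for z
      using that finite_Inv[OF w] by (intro Max_ge) simp_all
    then have set_zs: "set zs = I w" unfolding zs(2) by blast
    have "zs \<in> PS (affine_digraph n) (I w)" using zs set_zs by (simp add: PS_iff_Inv)
    moreover have "f (zs ! i) \<le> f (zs ! j) \<and> (zs ! j \<in> U_col n (zs ! i) \<longrightarrow> f (zs ! i) < f (zs ! j))"
      if ij: "i < j" "j < length zs" for i j
    proof -
      have le: "f (zs ! i) \<le> f (zs ! j)" using zs(3) ij by (auto simp: sorted_iff_nth_mono_less)
      moreover have "f (zs ! i) \<noteq> f (zs ! j)" if U: "zs ! j \<in> U_col n (zs ! i)"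
      proof
        assume e: "f (zs ! i) = f (zs ! j)"
        obtain a b a' b' where ab: "zs ! i = (a, b)" "zs ! j = (a', b')" by (cases "zs ! i", cases "zs ! j")
        have mem: "zs ! i \<in> I w" "zs ! j \<in> I w" using ij nth_mem[of i zs] nth_mem[of j zs] set_zs by auto
        then have "a' = a" using col U ab by metis
        then have "b = b'" using * mem e ab by metis
        with \<open>a' = a\<close> ab ij zs(1) show False by (metis less_irrefl less_trans nth_eq_iff_index_eq)
      qed
      ultimately show ?thesis by (simp add: le_neq_implies_less)
    qed
    ultimately show "semi_standard (affine_digraph n) (I w) (U_col n) f"
      unfolding semi_standard_def by blast
  qed
qed

end

subsection \<open>Factorizations and fillings\<close>

lemma formal_sum_reindex:
  assumes "bij_betw h S T" "\<And>i. i \<in> S \<Longrightarrow> mon' (h i) = mon i"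
  shows "formal_sum mon S = formal_sum mon' T"
proof -
  have "bij_betw h {i \<in> S. mon i = m} {j \<in> T. mon' j = m}" for m
    using assms unfolding bij_betw_def by (auto simp: inj_on_def image_iff)
  then have "card {i \<in> S. mon i = m} = card {j \<in> T. mon' j = m}" for m
    by (rule bij_betw_same_card)
  then show ?thesis by (simp add: formal_sum_def)
qed

context affine_type
begin

definition partial_product :: "(nat \<Rightarrow> int \<Rightarrow> int) \<Rightarrow> nat \<Rightarrow> int \<Rightarrow> int" where
  "partial_product v i = foldr (\<circ>) (map v [1..<Suc i]) id"

lemma partial_product_0: "partial_product v 0 = id"
  by (simp add: partial_product_def)

lemma partial_product_Suc: "partial_product v (Suc i) = partial_product v i \<circ> v (Suc i)"
proof -
  have "foldr (\<circ>) xs h = foldr (\<circ>) xs id \<circ> h" for xs and h :: "int \<Rightarrow> int"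
    by (induction xs) (simp_all only: foldr_Nil foldr_Cons o_apply comp_assoc id_comp id_apply)
  from this[of "map v [1..<Suc i]" "v (Suc i)"] show ?thesis
    by (simp add: partial_product_def)
qed

lemma partial_product_in_Aff:
  assumes "\<And>i. v (Suc i) \<in> Aff" shows "partial_product v i \<in> Aff"
proof (induction i)
  case 0
  show ?case by (simp only: partial_product_0 id_Aff)
next
  case (Suc i)
  then show ?case unfolding partial_product_Suc using assms by (rule comp_Aff)
qed

text \<open>Length is subadditive at each factor, so additivity of the whole product forces it at
  every step, where it is the inclusion of consecutive inversion sets.\<close>

lemma cyclic_factorizations_iff:
  assumes w: "w \<in> Aff"
  shows "v \<in> cyclic_factorizations n w \<longleftrightarrow>
    v 0 = undefined \<and> (\<forall>i. v (Suc i) \<in> Aff \<and> thin (v (Suc i))) \<and>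
    (\<forall>i. I (partial_product v i) \<subseteq> I (partial_product v (Suc i))) \<and>
    (\<exists>N. \<forall>i \<ge> N. partial_product v i = w)"
proof -
  have funcset: "v \<in> {1..} \<rightarrow>\<^sub>E cyclically_decreasing n \<longleftrightarrow>
    v 0 = undefined \<and> (\<forall>i. v (Suc i) \<in> Aff \<and> thin (v (Suc i)))"
    by (auto simp: PiE_iff extensional_def cyclically_decreasing_iff_thin Suc_le_eq dest!: gr0_implies_Suc)
  have Aff: "partial_product v i \<in> Aff" if "\<forall>i. v (Suc i) \<in> Aff" for i
    using that by (blast intro: partial_product_in_Aff)
  have step: "I (partial_product v i) \<subseteq> I (partial_product v (Suc i)) \<longleftrightarrow>
      card (I (partial_product v (Suc i))) = card (I (partial_product v i)) + card (I (v (Suc i)))"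
    "card (I (partial_product v (Suc i))) \<le> card (I (partial_product v i)) + card (I (v (Suc i)))"
    if v: "\<forall>i. v (Suc i) \<in> Aff" for i
  proof -
    let ?u = "partial_product v i" and ?w = "partial_product v (Suc i)"
    have uw: "?u \<in> Aff" "?w \<in> Aff" "v (Suc i) \<in> Aff" using Aff v by blast+
    have "inv ?u \<circ> ?w = v (Suc i)" using uw by (auto simp: partial_product_Suc)
    then show "I ?u \<subseteq> I ?w \<longleftrightarrow> card (I ?w) = card (I ?u) + card (I (v (Suc i)))"
      "card (I ?w) \<le> card (I ?u) + card (I (v (Suc i)))"
      using card_Inv_comp_eq[OF uw(1,2)] card_Inv_comp_le[OF uw(1,3)]
      unfolding partial_product_Suc by auto
  qed
  have len: "coxeter_length n (v (Suc i)) = card (I (v (Suc i)))" if "\<forall>i. v (Suc i) \<in> Aff" for i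
    using that coxeter_length_eq_card_Inv by blast
  have total: "card (I (partial_product v N)) \<le> (\<Sum>i = 1..N. coxeter_length n (v i)) \<and>
      (card (I (partial_product v N)) = (\<Sum>i = 1..N. coxeter_length n (v i)) \<longleftrightarrow>
        (\<forall>i < N. I (partial_product v i) \<subseteq> I (partial_product v (Suc i))))"
    if v: "\<forall>i. v (Suc i) \<in> Aff" for N
  proof (induction N)
    case 0
    have "I (partial_product v 0) = {}" by (simp only: partial_product_0 Inv_id)
    then show ?case by simp
  next
    case (Suc N)
    let ?c = "\<lambda>i. card (I (partial_product v i))"
    let ?s = "\<lambda>N. \<Sum>i = 1..N. coxeter_length n (v i)"
    have s: "?s (Suc N) = ?s N + card (I (v (Suc N)))"
      by (simp add: len[OF v])
    have "?c (Suc N) \<le> ?s (Suc N)" using Suc.IH step(2)[OF v, of N] s by linarith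
    moreover have "?c (Suc N) = ?s (Suc N) \<longleftrightarrow> ?c N = ?s N \<and> ?c (Suc N) = ?c N + card (I (v (Suc N)))"
      using Suc.IH step(2)[OF v, of N] s by linarith
    ultimately show ?case
      using Suc.IH step(1)[OF v, of N] unfolding All_less_Suc by blast
  qed
  show ?thesis
  proof
    assume "v \<in> cyclic_factorizations n w"
    then obtain N where v: "v 0 = undefined" "\<forall>i. v (Suc i) \<in> Aff" "\<forall>i. thin (v (Suc i))"
      and N: "\<forall>i > N. v i = id" "w = partial_product v N"
        "coxeter_length n w = (\<Sum>i = 1..N. coxeter_length n (v i))"
      unfolding cyclic_factorizations_def using funcset by (auto simp: partial_product_def)
    have const: "partial_product v i = w" if "N \<le> i" for i
      using that
    proof (induction i rule: dec_induct)
      case base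
      show ?case using N by simp
    next
      case (step i)
      then have "v (Suc i) = id" using N by simp
      with step show ?case by (simp only: partial_product_Suc comp_id)
    qed
    have "card (I (partial_product v N)) = (\<Sum>i = 1..N. coxeter_length n (v i))"
      using N w coxeter_length_eq_card_Inv by simp
    then have below: "\<forall>i < N. I (partial_product v i) \<subseteq> I (partial_product v (Suc i))"
      using total[OF v(2)] by blast
    have "I (partial_product v i) \<subseteq> I (partial_product v (Suc i))" for i
    proof (cases "i < N")
      case False
      then have "partial_product v i = w" "partial_product v (Suc i) = w" using const by simp_all
      then show ?thesis by simp
    qed (use below in blast)
    with v const show "v 0 = undefined \<and> (\<forall>i. v (Suc i) \<in> Aff \<and> thin (v (Suc i))) \<and>
      (\<forall>i. I (partial_product v i) \<subseteq> I (partial_product v (Suc i))) \<and>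
      (\<exists>N. \<forall>i \<ge> N. partial_product v i = w)" by blast
  next
    assume R: "v 0 = undefined \<and> (\<forall>i. v (Suc i) \<in> Aff \<and> thin (v (Suc i))) \<and>
      (\<forall>i. I (partial_product v i) \<subseteq> I (partial_product v (Suc i))) \<and>
      (\<exists>N. \<forall>i \<ge> N. partial_product v i = w)"
    then obtain N where N: "\<forall>i \<ge> N. partial_product v i = w" by blast
    have v: "\<forall>i. v (Suc i) \<in> Aff" using R by blast
    have "v i = id" if i: "i > N" for i
    proof -
      obtain k where k: "i = Suc k" "N \<le> k" using i by (cases i) auto
      \<comment> \<open>Beyond \<open>N\<close> the partial products stay at \<open>w\<close>, which
        cancels.\<close>
      then have wv: "w \<circ> v (Suc k) = w" using N partial_product_Suc[of v k] by simp
      have "v (Suc k) x = x" for x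
        using fun_cong[OF wv, of x] Aff_eq_iff[OF w] by simp
      with k show ?thesis by auto
    qed
    moreover have "coxeter_length n w = (\<Sum>i = 1..N. coxeter_length n (v i))"
      using total[OF v, of N] R N w coxeter_length_eq_card_Inv[OF w] by simp
    moreover have "v \<in> {1..} \<rightarrow>\<^sub>E cyclically_decreasing n" using R funcset by blast
    ultimately show "v \<in> cyclic_factorizations n w"
      using N unfolding cyclic_factorizations_def partial_product_def by blast
  qed
qed

definition filling :: "(int \<Rightarrow> int) \<Rightarrow> (nat \<Rightarrow> int \<Rightarrow> int) \<Rightarrow> nat \<times> nat \<Rightarrow> nat" where
  "filling w v = (\<lambda>z \<in> I w. LEAST i. z \<in> I (partial_product v i))"

context
  fixes w v
  assumes w: "w \<in> Aff" and v: "v \<in> cyclic_factorizations n w"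
begin

lemma partial_product_Aff: "partial_product v i \<in> Aff"
  using v unfolding cyclic_factorizations_iff[OF w] by (blast intro: partial_product_in_Aff)

lemma partial_product_mono:
  assumes "i \<le> j" shows "I (partial_product v i) \<subseteq> I (partial_product v j)"
proof -
  have "I (partial_product v k) \<subseteq> I (partial_product v (Suc k))" for k
    using v unfolding cyclic_factorizations_iff[OF w] by blast
  then show ?thesis using assms by (rule lift_Suc_mono_le)
qed

lemma partial_product_subset: "I (partial_product v i) \<subseteq> I w"
proof -
  obtain N where "\<forall>i \<ge> N. partial_product v i = w" using v unfolding cyclic_factorizations_iff[OF w] by blast
  then have "partial_product v (max i N) = w" by simp
  with partial_product_mono[of i "max i N"] show ?thesis by simp
qed

text \<open>The chain of inversion sets grows and reaches \<open>I w\<close>, so the least index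
  exists and all later indices qualify. Sublevel sets of the filling are thereby inversion sets of
  partial products.\<close>

lemma filling_le_iff:
  assumes "z \<in> I w" shows "filling w v z \<le> i \<longleftrightarrow> z \<in> I (partial_product v i)"
proof -
  obtain N where "\<forall>i \<ge> N. partial_product v i = w" using v unfolding cyclic_factorizations_iff[OF w] by blast
  then have "z \<in> I (partial_product v N)" using assms by simp
  then have "z \<in> I (partial_product v (LEAST i. z \<in> I (partial_product v i)))" by (rule LeastI)
  then have "z \<in> I (partial_product v (filling w v z))" using assms by (simp add: filling_def)
  moreover have "filling w v z \<le> i" if "z \<in> I (partial_product v i)"
    using that assms by (simp add: filling_def Least_le)
  ultimately show ?thesis using partial_product_mono[of "filling w v z" i] by blast
qed

lemma filling_level: "{z \<in> I w. filling w v z \<le> i} = I (partial_product v i)"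
  using filling_le_iff partial_product_subset[of i] by blast

lemma filling_pos: "z \<in> I w \<Longrightarrow> 1 \<le> filling w v z"
  using filling_le_iff[of z 0] unfolding partial_product_0 Inv_id by (simp add: not_le)

lemma quotient_partial_product: "inv (partial_product v i) \<circ> partial_product v (Suc i) = v (Suc i)"
  using partial_product_Aff[of i] by (auto simp: partial_product_Suc)

lemma filling_eq_Suc: "{z \<in> I w. filling w v z = Suc i} = I (partial_product v (Suc i)) - I (partial_product v i)"
  using filling_level[of i] filling_level[of "Suc i"] by force

lemma filling_semi_standard:
  "filling w v \<in> I w \<rightarrow>\<^sub>E {1..}" "semi_standard (affine_digraph n) (I w) (U_col n) (filling w v)"
proof -
  show "filling w v \<in> I w \<rightarrow>\<^sub>E {1..}"
    using filling_pos by (auto simp: filling_def)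
  have pos: "\<forall>z \<in> I w. 1 \<le> filling w v z" using filling_pos by blast
  have "b = b'" if ab: "(a, b) \<in> I w" "(a, b') \<in> I w" "filling w v (a, b) = filling w v (a, b')" for a b b'
  proof -
    obtain i where i: "filling w v (a, b) = Suc i"
      using filling_pos[OF ab(1)] by (cases "filling w v (a, b)") auto
    have "thin (inv (partial_product v i) \<circ> partial_product v (Suc i))"
      using v unfolding quotient_partial_product cyclic_factorizations_iff[OF w] by blast
    moreover have "(a, b) \<in> I (partial_product v (Suc i)) - I (partial_product v i)"
      "(a, b') \<in> I (partial_product v (Suc i)) - I (partial_product v i)"
      using ab i unfolding filling_eq_Suc [symmetric] by auto
    ultimately show "b = b'"
      using thin_quotient_iff[OF partial_product_Aff partial_product_Aff partial_product_mono] by (meson le_SucI order_refl)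
  qed
  then show "semi_standard (affine_digraph n) (I w) (U_col n) (filling w v)"
    unfolding semi_standard_iff[OF w pos] filling_level using partial_product_Aff by blast
qed

lemma card_filling: "card {z \<in> I w. filling w v z = Suc i} = coxeter_length n (v (Suc i))"
proof -
  let ?u = "partial_product v i" and ?u' = "partial_product v (Suc i)"
  have sub: "I ?u \<subseteq> I ?u'" by (rule partial_product_mono) simp
  have "v (Suc i) \<in> Aff" using v unfolding cyclic_factorizations_iff[OF w] by blast
  then have "coxeter_length n (v (Suc i)) = card (I (inv ?u \<circ> ?u'))"
    by (simp only: quotient_partial_product coxeter_length_eq_card_Inv)
  also have "\<dots> = card (I ?u') - card (I ?u)"
    using card_Inv_comp_eq[OF partial_product_Aff partial_product_Aff sub] by simp
  also have "\<dots> = card (I ?u' - I ?u)"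
    using sub finite_Inv[OF partial_product_Aff] by (simp add: card_Diff_subset)
  finally show ?thesis by (simp only: filling_eq_Suc)
qed

text \<open>The exponent of each variable \<open>k \<ge> 1\<close> is the number of inversions added
  by the factor \<open>v k\<close>, which is its length.\<close>

lemma monomial_filling:
  "(\<Sum>z \<in> I w. Poly_Mapping.single (filling w v z) 1) =
    (\<Sum>i \<in> {i. 1 \<le> i \<and> v i \<noteq> id}. Poly_Mapping.single i (coxeter_length n (v i)))"
proof (rule poly_mapping_eqI)
  fix k
  let ?S = "{i. 1 \<le> i \<and> v i \<noteq> id}"
  obtain N where "\<forall>i > N. v i = id" using v by (auto simp: cyclic_factorizations_def)
  \<comment> \<open>A sum over an infinite index set would be 0 by convention.\<close>
  then have fin: "finite ?S" by (intro finite_subset[of ?S "{..N}"]) (auto simp: not_less [symmetric])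
  have "Poly_Mapping.lookup (\<Sum>z \<in> I w. Poly_Mapping.single (filling w v z) (1::nat)) k
      = card {z \<in> I w. filling w v z = k}"
    using finite_Inv[OF w]
    by (simp add: lookup_sum lookup_single when_def sum.If_cases Int_def conj_commute)
  also have "\<dots> = (if k \<in> ?S then coxeter_length n (v k) else 0)"
  proof (cases k)
    case 0
    then have empty: "{z \<in> I w. filling w v z = k} = {}" using filling_pos by force
    show ?thesis unfolding empty using 0 by simp
  next
    case (Suc i)
    \<comment> \<open>Trivial factors are left out of the index set but contribute exponent 0
      anyway.\<close>
    have "coxeter_length n id = 0" unfolding coxeter_length_eq_card_Inv[OF id_Aff] by simp
    with Suc show ?thesis by (auto simp: card_filling)
  qed
  also have "\<dots> = Poly_Mapping.lookup (\<Sum>i \<in> ?S. Poly_Mapping.single i (coxeter_length n (v i))) k"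
    using fin by (simp add: lookup_sum lookup_single when_def)
  finally show "Poly_Mapping.lookup (\<Sum>z \<in> I w. Poly_Mapping.single (filling w v z) 1) k =
    Poly_Mapping.lookup (\<Sum>i \<in> ?S. Poly_Mapping.single i (coxeter_length n (v i))) k" .
qed

end

text \<open>The filling determines the inversion sets of the partial products, these determine the
  products, and their quotients are the factors.\<close>

lemma filling_inj:
  assumes w: "w \<in> Aff"
    and v: "v \<in> cyclic_factorizations n w" "v' \<in> cyclic_factorizations n w"
    and eq: "filling w v = filling w v'"
  shows "v = v'"
proof
  fix i
  have "I (partial_product v k) = I (partial_product v' k)" for k
    unfolding filling_level[OF w v(1), symmetric] filling_level[OF w v(2), symmetric] eq ..
  then have P: "partial_product v k = partial_product v' k" for k
    using inj_onD[OF inj_on_Inv _ partial_product_Aff[OF w v(1)] partial_product_Aff[OF w v(2)]] by blast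
  show "v i = v' i"
  proof (cases i)
    case 0
    with v show ?thesis unfolding cyclic_factorizations_iff[OF w] by simp
  next
    case (Suc k)
    show ?thesis unfolding Suc
      unfolding quotient_partial_product[OF w v(1), symmetric] quotient_partial_product[OF w v(2), symmetric] P ..
  qed
qed

text \<open>The sublevel sets of \<open>f\<close> are inversion sets of a chain
  \<open>u 0, u 1, ...\<close> from \<open>id\<close> to \<open>w\<close>; the factors are its
  successive quotients.\<close>

lemma filling_surj:
  assumes w: "w \<in> Aff" and f: "f \<in> I w \<rightarrow>\<^sub>E {1..}"
    and ss: "semi_standard (affine_digraph n) (I w) (U_col n) f"
  shows "\<exists>v \<in> cyclic_factorizations n w. f = filling w v"
proof -
  have pos: "\<forall>z \<in> I w. 1 \<le> f z" using f by auto
  have ex: "\<exists>u \<in> Aff. I u = {z \<in> I w. f z \<le> i}" for i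
  proof -
    have "{z \<in> I w. f z \<le> i} \<in> I ` Aff" using ss semi_standard_iff[OF w pos] by blast
    then obtain u where "{z \<in> I w. f z \<le> i} = I u" "u \<in> Aff" by (rule imageE)
    then show ?thesis by (intro bexI[of _ u]) (rule sym)
  qed
  then obtain u where u: "\<And>i. u i \<in> Aff" "\<And>i. I (u i) = {z \<in> I w. f z \<le> i}" by metis
  define v where "v i = (case i of 0 \<Rightarrow> undefined | Suc k \<Rightarrow> inv (u k) \<circ> u (Suc k))" for i
  have vS: "v (Suc k) = inv (u k) \<circ> u (Suc k)" for k by (simp add: v_def)
  have sub: "I (u k) \<subseteq> I (u (Suc k))" for k using u by auto
  have P: "partial_product v i = u i" for i
  proof (induction i)
    case 0
    have "I (u 0) = {}" using pos by (force simp: u)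
    then have "u 0 = id" using inj_onD[OF inj_on_Inv _ u(1) id_Aff] by simp
    then show ?case by (simp only: partial_product_0)
  next
    case (Suc i)
    have "u i \<circ> (inv (u i) \<circ> u (Suc i)) = u (Suc i)" using u(1) by auto
    then show ?case by (simp only: partial_product_Suc Suc vS)
  qed
  have "thin (v (Suc k))" for k
    unfolding vS thin_quotient_iff[OF u(1) u(1) sub]
  proof (intro allI impI)
    fix a b b' assume *: "(a, b) \<in> I (u (Suc k)) - I (u k)" "(a, b') \<in> I (u (Suc k)) - I (u k)"
    then have "f (a, b) = Suc k" "f (a, b') = Suc k" by (auto simp: u)
    with * show "b = b'" using ss semi_standard_iff[OF w pos] by (auto simp: u)
  qed
  moreover have "v (Suc k) \<in> Aff" for k using u(1) by (simp only: vS comp_Aff inv_Aff)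
  moreover have "u i = w" if i: "i \<ge> Max (f ` I w)" for i
  proof -
    have "f z \<le> Max (f ` I w)" if "z \<in> I w" for z
      using that finite_Inv[OF w] by (intro Max_ge) simp_all
    with i have "f z \<le> i" if "z \<in> I w" for z
      using that by (meson le_trans)
    then have "I (u i) = I w" by (auto simp: u)
    then show ?thesis using inj_onD[OF inj_on_Inv _ u(1) w] by blast
  qed
  ultimately have v: "v \<in> cyclic_factorizations n w"
    unfolding cyclic_factorizations_iff[OF w] P using sub by (auto simp: v_def)
  have "f z = filling w v z" for z
  proof (cases "z \<in> I w")
    case True
    \<comment> \<open>Two numbers with the same upper bounds are equal.\<close>
    have "filling w v z \<le> i \<longleftrightarrow> f z \<le> i" for i
      using filling_le_iff[OF w v True, of i] True by (simp add: P u)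
    then show ?thesis by (metis le_antisym order_refl)
  next
    case False
    with f show ?thesis by (auto simp: filling_def)
  qed
  with v show ?thesis by blast
qed

end

theorem theorem7:
  fixes n :: nat and \<omega> :: "int \<Rightarrow> int"
  assumes "n \<ge> 3"
    and "\<omega> \<in> affine_permutations n"
  shows "affine_stanley n \<omega> = Gamma_series (affine_digraph n) (Inv_affine n \<omega>) (U_col n)"
proof -
  interpret affine_type n by standard fact
  note \<omega> = assms(2)
  let ?T = "{f \<in> I \<omega> \<rightarrow>\<^sub>E {1..}. semi_standard (affine_digraph n) (I \<omega>) (U_col n) f}"
  have "inj_on (filling \<omega>) (cyclic_factorizations n \<omega>)"
    using filling_inj[OF \<omega>] by (rule inj_onI)
  moreover have "filling \<omega> ` cyclic_factorizations n \<omega> \<subseteq> ?T"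
    using filling_semi_standard[OF \<omega>] by blast
  moreover have "?T \<subseteq> filling \<omega> ` cyclic_factorizations n \<omega>"
    using filling_surj[OF \<omega>] by blast
  ultimately have "bij_betw (filling \<omega>) (cyclic_factorizations n \<omega>) ?T"
    unfolding bij_betw_def by blast
  then show ?thesis
    unfolding affine_stanley_def Gamma_series_def
    by (rule formal_sum_reindex) (rule monomial_filling[OF \<omega>])
qed

end
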